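(* Let $\mathrm{ZFI}^\ast$ be the theory $\mathrm{ZF}+\mathrm{Coll}(I)+\mathrm{Cof}(I)+\mathrm{Indis}(I)$ and $\mathrm{ZFI}^\ast_<$ the theory $\mathrm{ZF}(<)+\mathrm{GW}+\mathrm{Coll}(<,I)+\mathrm{Cof}(I)+\mathrm{Indis}_<(I)$. Then: (a) $\mathrm{ZFI}^\ast$ proves, for every $n\in\omega$ and every $\mathcal{L}_{\mathrm{Set}}$-formula $\varphi(x_1,\dots,x_n,y)$, the apartness sentence $\forall i\in I\ \forall j\in I\,[i<j\to\forall\bar x\in(\mathrm{V}(i))^n\,(\exists y\,\varphi(\bar x,y)\to\exists y\in\mathrm{V}(j)\,\varphi(\bar x,y))]$; (b) $\mathrm{ZFI}^\ast$ proves, for all $n,r\in\omega$ with $r\ge1$ and every $\mathcal{L}_{\mathrm{Set}}$-formula $\varphi$ with free variables among $\bar x=(x_1,\dots,x_n)$ and $n+1+r$ total arguments, the diagonal indiscernibility sentence $\forall i\in I\ \forall\bar j\in[I]^r\ \forall\bar k\in[I]^r\,[(i<j_1\wedge i<k_1)\to\forall\bar x\in(\mathrm{V}(i))^n\,(\varphi(\bar x,i,j_1,\dots,j_r)\leftrightarrow\varphi(\bar x,i,k_1,\dots,k_r))]$; (c) $\mathrm{ZFI}^\ast_<$ proves the apartness sentences of (a) for all $\mathcal{L}_{\mathrm{Set}}(<)$-formulae $\varphi$; (d) $\mathrm{ZFI}^\ast_<$ proves the diagonal indiscernibility sentences of (b) for all $\mathcal{L}_{\mathrm{Set}}(<)$-formulae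 $\varphi$.
   Context: $\mathcal{L}_{\mathrm{Set}}=\{=,\in\}$, $I$ a unary predicate, $<$ a binary relation symbol. $\mathrm{ZF}(<)$ is ZF with separation and collection for $\mathcal{L}_{\mathrm{Set}}\cup\{<\}$-formulae. $\mathrm{Coll}(I)$ is the collection scheme $(\forall x\in v\,\exists y\,\psi)\to\exists w\,\forall x\in v\,\exists y\in w\,\psi$ for $\mathcal{L}_{\mathrm{Set}}\cup\{I\}$-formulae $\psi$ (with parameters); $\mathrm{Coll}(<,I)$ is the same for $\mathcal{L}_{\mathrm{Set}}\cup\{<,I\}$-formulae. $\mathrm{GW}$: "$<$ is a linear order and every nonempty set has a $<$-least element". $\mathrm{Cof}(I)$: "$I$ is a cofinal subclass of $\mathrm{Ord}$". $\mathrm{Indis}(I)$ (resp. $\mathrm{Indis}_<(I)$): for each $\mathcal{L}_{\mathrm{Set}}$- (resp. $\mathcal{L}_{\mathrm{Set}}(<)$-) formula $\varphi(v_1,\dots,v_n)$, for all $x_1\in\cdots\in x_n$ and $y_1\in\cdots\in y_n$ from $I$, $\varphi(\bar x)\leftrightarrow\varphi(\bar y)$. For ordinals $i<j$ means $i\in j$; $[I]^r$ is the class of increasing $r$-tuples from $I$; $\mathrm{V}(i)$ is the $i$-th level of the von Neumann hierarchy. *)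

theory Defs
  imports Main
begin

section \<open>First-order formulae\<close>

text \<open>
  Formulae over equality, membership, a binary symbol \<open><\<close> and a unary symbol \<open>I\<close>, with de Bruijn
  indices as variables: below \<open>All\<close>, index 0 is the bound variable and the outer indices are
  shifted by one.
\<close>

datatype fm =
    Eq nat nat  (infix "\<^bold>=" 58)
  | Mem nat nat  (infix "\<^bold>\<in>" 58)
  | Less nat nat  (infix "\<^bold><" 58)
  | InI nat
  | Bot
  | Imp fm fm  (infixr "\<^bold>\<longrightarrow>" 54)
  | All fm

definition Neg :: "fm \<Rightarrow> fm" where
  "Neg p = (p \<^bold>\<longrightarrow> Bot)"

definition Top :: fm where
  "Top = Neg Bot"

definition Or :: "fm \<Rightarrow> fm \<Rightarrow> fm"  (infixr "\<^bold>\<or>" 55) where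
  "(p \<^bold>\<or> q) = (Neg p \<^bold>\<longrightarrow> q)"

definition And :: "fm \<Rightarrow> fm \<Rightarrow> fm"  (infixr "\<^bold>\<and>" 56) where
  "(p \<^bold>\<and> q) = Neg (p \<^bold>\<longrightarrow> Neg q)"

definition Iff :: "fm \<Rightarrow> fm \<Rightarrow> fm"  (infix "\<^bold>\<longleftrightarrow>" 53) where
  "(p \<^bold>\<longleftrightarrow> q) = ((p \<^bold>\<longrightarrow> q) \<^bold>\<and> (q \<^bold>\<longrightarrow> p))"

definition Ex :: "fm \<Rightarrow> fm" where
  "Ex p = Neg (All (Neg p))"

definition BAll :: "nat \<Rightarrow> fm \<Rightarrow> fm" where
  "BAll v p = All (0 \<^bold>\<in> Suc v \<^bold>\<longrightarrow> p)"

definition BEx :: "nat \<Rightarrow> fm \<Rightarrow> fm" where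
  "BEx v p = Ex (0 \<^bold>\<in> Suc v \<^bold>\<and> p)"

definition Alls :: "nat \<Rightarrow> fm \<Rightarrow> fm" where
  "Alls n = All ^^ n"

definition Conj :: "fm list \<Rightarrow> fm" where
  "Conj ps = foldr And ps Top"

primrec fv :: "fm \<Rightarrow> nat set" where
  "fv (a \<^bold>= b) = {a, b}"
| "fv (a \<^bold>\<in> b) = {a, b}"
| "fv (a \<^bold>< b) = {a, b}"
| "fv (InI a) = {a}"
| "fv Bot = {}"
| "fv (p \<^bold>\<longrightarrow> q) = fv p \<union> fv q"
| "fv (All p) = {v. Suc v \<in> fv p}"

datatype sym = LessSym | ISym

primrec syms :: "fm \<Rightarrow> sym set" where
  "syms (a \<^bold>= b) = {}"
| "syms (a \<^bold>\<in> b) = {}"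
| "syms (a \<^bold>< b) = {LessSym}"
| "syms (InI a) = {ISym}"
| "syms Bot = {}"
| "syms (p \<^bold>\<longrightarrow> q) = syms p \<union> syms q"
| "syms (All p) = syms p"

text \<open>
  \<open>formulas L k\<close>: the formulae with arguments \<open>0, \<dots>, k - 1\<close> in the language of set theory extended
  by the symbols in \<open>L\<close>; thus \<open>L = {}\<close> is the language of set theory itself.
\<close>

definition formulas :: "sym set \<Rightarrow> nat \<Rightarrow> fm set" where
  "formulas L k = {p. syms p \<subseteq> L \<and> fv p \<subseteq> {..<k}}"

text \<open>
  Simultaneous capture-avoiding substitution of variables for variables. There are no function
  symbols, so this covers all substitution of terms.
\<close>

primrec rename :: "(nat \<Rightarrow> nat) \<Rightarrow> fm \<Rightarrow> fm" where
  "rename f (a \<^bold>= b) = (f a \<^bold>= f b)"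
| "rename f (a \<^bold>\<in> b) = (f a \<^bold>\<in> f b)"
| "rename f (a \<^bold>< b) = (f a \<^bold>< f b)"
| "rename f (InI a) = InI (f a)"
| "rename f Bot = Bot"
| "rename f (p \<^bold>\<longrightarrow> q) = (rename f p \<^bold>\<longrightarrow> rename f q)"
| "rename f (All p) = All (rename (\<lambda>v. case v of 0 \<Rightarrow> 0 | Suc m \<Rightarrow> Suc (f m)) p)"

text \<open>Instantiation of the variable 0 of the body of a quantifier.\<close>

definition inst :: "fm \<Rightarrow> nat \<Rightarrow> fm" where
  "inst p t = rename (\<lambda>v. case v of 0 \<Rightarrow> t | Suc m \<Rightarrow> m) p"

text \<open>The formula \<open>p(v\<^sub>0, \<dots>, v\<^sub>k\<^sub>-\<^sub>1)\<close> for \<open>p \<in> formulas L k\<close> and a list of \<open>k\<close> variables.\<close>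

definition app :: "fm \<Rightarrow> nat list \<Rightarrow> fm" where
  "app p vs = rename (\<lambda>m. vs ! m) p"

section \<open>Provability\<close>

text \<open>
  Classical natural deduction with equality. The assumptions discharged in a derivation must be in
  the language \<open>L\<close>; so if the hypotheses are in \<open>L\<close>, all formulae of the derivation are.
\<close>

inductive derives :: "sym set \<Rightarrow> fm set \<Rightarrow> fm \<Rightarrow> bool" for L :: "sym set" where
  Assm: "p \<in> \<Gamma> \<Longrightarrow> derives L \<Gamma> p"
| ImpI: "syms p \<subseteq> L \<Longrightarrow> derives L (insert p \<Gamma>) q \<Longrightarrow> derives L \<Gamma> (p \<^bold>\<longrightarrow> q)"
| ImpE: "derives L \<Gamma> (p \<^bold>\<longrightarrow> q) \<Longrightarrow> derives L \<Gamma> p \<Longrightarrow> derives L \<Gamma> q"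
| Contr: "syms p \<subseteq> L \<Longrightarrow> derives L (insert (Neg p) \<Gamma>) Bot \<Longrightarrow> derives L \<Gamma> p"
| AllI: "derives L (rename Suc ` \<Gamma>) p \<Longrightarrow> derives L \<Gamma> (All p)"
| AllE: "derives L \<Gamma> (All p) \<Longrightarrow> derives L \<Gamma> (inst p t)"
| EqRefl: "derives L \<Gamma> (a \<^bold>= a)"
| EqSubst: "derives L \<Gamma> (a \<^bold>= b) \<Longrightarrow> derives L \<Gamma> (inst p a) \<Longrightarrow> derives L \<Gamma> (inst p b)"

section \<open>Set-theoretic notions\<close>

definition Sub :: "nat \<Rightarrow> nat \<Rightarrow> fm" where
  "Sub a b = BAll a (0 \<^bold>\<in> Suc b)"

definition Nonempty :: "nat \<Rightarrow> fm" where
  "Nonempty a = Ex (0 \<^bold>\<in> Suc a)"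

text \<open>\<open>s = x \<union> {x}\<close>\<close>
definition IsSucc :: "nat \<Rightarrow> nat \<Rightarrow> fm" where
  "IsSucc s x = All (0 \<^bold>\<in> Suc s \<^bold>\<longleftrightarrow> (0 \<^bold>\<in> Suc x \<^bold>\<or> 0 \<^bold>= Suc x))"

text \<open>\<open>p = {a, b}\<close>\<close>
definition IsUPair :: "nat \<Rightarrow> nat \<Rightarrow> nat \<Rightarrow> fm" where
  "IsUPair p a b = All (0 \<^bold>\<in> Suc p \<^bold>\<longleftrightarrow> (0 \<^bold>= Suc a \<^bold>\<or> 0 \<^bold>= Suc b))"

text \<open>\<open>p = {{a}, {a, b}}\<close>\<close>
definition IsOPair :: "nat \<Rightarrow> nat \<Rightarrow> nat \<Rightarrow> fm" where
  "IsOPair p a b = Ex (Ex (IsUPair 1 (a + 2) (a + 2) \<^bold>\<and> IsUPair 0 (a + 2) (b + 2) \<^bold>\<and> IsUPair (p + 2) 1 0))"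

text \<open>\<open>(a, b) \<in> f\<close>\<close>
definition Maps :: "nat \<Rightarrow> nat \<Rightarrow> nat \<Rightarrow> fm" where
  "Maps f a b = BEx f (IsOPair 0 (Suc a) (Suc b))"

text \<open>\<open>x\<close> is transitive and strictly well-ordered by membership.\<close>
definition Ord :: "nat \<Rightarrow> fm" where
  "Ord x = Conj
    [BAll x (Sub 0 (x + 1)),
     BAll x (Neg (0 \<^bold>\<in> 0)),
     BAll x (BAll (x + 1) (BAll (x + 2) (2 \<^bold>\<in> 1 \<^bold>\<and> 1 \<^bold>\<in> 0 \<^bold>\<longrightarrow> 2 \<^bold>\<in> 0))),
     BAll x (BAll (x + 1) (1 \<^bold>\<in> 0 \<^bold>\<or> 1 \<^bold>= 0 \<^bold>\<or> 0 \<^bold>\<in> 1)),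
     All (Sub 0 (x + 1) \<^bold>\<and> Nonempty 0 \<^bold>\<longrightarrow> BEx 0 (BAll 1 (1 \<^bold>\<in> 0 \<^bold>\<or> 1 \<^bold>= 0)))]"

text \<open>
  \<open>v = V(a)\<close>: there is a function \<open>f\<close> with domain \<open>a \<union> {a}\<close> such that
  \<open>f(\<beta>)\<close> is the union of the power sets of the \<open>f(\<gamma>)\<close>, \<open>\<gamma> \<in> \<beta>\<close>, for all \<open>\<beta>\<close> in the domain,
  and \<open>f(a) = v\<close>.
\<close>
definition IsV :: "nat \<Rightarrow> nat \<Rightarrow> fm" where
  "IsV a v = Ex (Conj
    [BAll 0 (Ex (Ex (IsOPair 2 1 0 \<^bold>\<and> (1 \<^bold>\<in> a + 4 \<^bold>\<or> 1 \<^bold>= a + 4)))),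
     All (0 \<^bold>\<in> a + 2 \<^bold>\<or> 0 \<^bold>= a + 2 \<^bold>\<longrightarrow> Ex (All (Maps 3 2 0 \<^bold>\<longleftrightarrow> 0 \<^bold>= 1))),
     All (All ((1 \<^bold>\<in> a + 3 \<^bold>\<or> 1 \<^bold>= a + 3) \<^bold>\<and> Maps 2 1 0 \<^bold>\<longrightarrow>
       All (0 \<^bold>\<in> 1 \<^bold>\<longleftrightarrow> Ex (Ex (1 \<^bold>\<in> 4 \<^bold>\<and> Maps 5 1 0 \<^bold>\<and> Sub 2 0))))),
     Maps 0 (a + 1) (v + 1)])"

text \<open>\<open>x \<in> V(a)\<close>\<close>
definition InV :: "nat \<Rightarrow> nat \<Rightarrow> fm" where
  "InV x a = Ex (IsV (a + 1) 0 \<^bold>\<and> x + 1 \<^bold>\<in> 0)"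

text \<open>The listed variables form an increasing tuple from \<open>I\<close>.\<close>
fun IncrI :: "nat list \<Rightarrow> fm" where
  "IncrI [] = Top"
| "IncrI [u] = InI u"
| "IncrI (u # v # vs) = (InI u \<^bold>\<and> u \<^bold>\<in> v \<^bold>\<and> IncrI (v # vs))"

section \<open>The theories\<close>

definition Extensionality :: fm where
  "Extensionality = All (All (All (0 \<^bold>\<in> 2 \<^bold>\<longleftrightarrow> 0 \<^bold>\<in> 1) \<^bold>\<longrightarrow> 1 \<^bold>= 0))"

definition Foundation :: fm where
  "Foundation = All (Nonempty 0 \<^bold>\<longrightarrow> BEx 0 (BAll 1 (Neg (0 \<^bold>\<in> 1))))"

definition Pairing :: fm where
  "Pairing = All (All (Ex (IsUPair 0 2 1)))"

definition Union :: fm where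
  "Union = All (Ex (All (0 \<^bold>\<in> 1 \<^bold>\<longleftrightarrow> BEx 2 (1 \<^bold>\<in> 0))))"

definition Powerset :: fm where
  "Powerset = All (Ex (All (0 \<^bold>\<in> 1 \<^bold>\<longleftrightarrow> Sub 0 2)))"

definition Infinity :: fm where
  "Infinity = Ex (BEx 0 (Neg (Nonempty 0)) \<^bold>\<and> BAll 0 (BEx 1 (IsSucc 0 1)))"

text \<open>
  \<open>\<forall>z\<^sub>1 \<dots> z\<^sub>n \<forall>v \<exists>w \<forall>x (x \<in> w \<longleftrightarrow> x \<in> v \<and> p(x, z\<^sub>1, \<dots>, z\<^sub>n))\<close>
\<close>
definition separation :: "nat \<Rightarrow> fm \<Rightarrow> fm" where
  "separation n p = Alls n (All (Ex (All (0 \<^bold>\<in> 1 \<^bold>\<longleftrightarrow> (0 \<^bold>\<in> 2 \<^bold>\<and> app p (0 # [3..<n + 3]))))))"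

text \<open>
  \<open>\<forall>z\<^sub>1 \<dots> z\<^sub>n \<forall>v ((\<forall>x \<in> v. \<exists>y. p(x, y, z\<^sub>1, \<dots>, z\<^sub>n)) \<longrightarrow> \<exists>w. \<forall>x \<in> v. \<exists>y \<in> w. p(x, y, z\<^sub>1, \<dots>, z\<^sub>n))\<close>
\<close>
definition collection :: "nat \<Rightarrow> fm \<Rightarrow> fm" where
  "collection n p = Alls n (All
    (BAll 0 (Ex (app p ([1, 0] @ [3..<n + 3]))) \<^bold>\<longrightarrow>
     Ex (BAll 1 (BEx 1 (app p ([1, 0] @ [4..<n + 4]))))))"

definition Sep :: "sym set \<Rightarrow> fm set" where
  "Sep L = {separation n p | n p. p \<in> formulas L (n + 1)}"

definition Coll :: "sym set \<Rightarrow> fm set" where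
  "Coll L = {collection n p | n p. p \<in> formulas L (n + 2)}"

definition ZF :: "sym set \<Rightarrow> fm set" where
  "ZF L = {Extensionality, Foundation, Pairing, Union, Powerset, Infinity} \<union> Sep L \<union> Coll L"

definition GW :: fm where
  "GW = Conj
    [All (Neg (0 \<^bold>< 0)),
     All (All (All (2 \<^bold>< 1 \<^bold>\<and> 1 \<^bold>< 0 \<^bold>\<longrightarrow> 2 \<^bold>< 0))),
     All (All (1 \<^bold>< 0 \<^bold>\<or> 1 \<^bold>= 0 \<^bold>\<or> 0 \<^bold>< 1)),
     All (Nonempty 0 \<^bold>\<longrightarrow> BEx 0 (BAll 1 (1 \<^bold>< 0 \<^bold>\<or> 1 \<^bold>= 0)))]"

definition Cof :: fm where
  "Cof = (All (InI 0 \<^bold>\<longrightarrow> Ord 0) \<^bold>\<and> All (Ord 0 \<^bold>\<longrightarrow> Ex (InI 0 \<^bold>\<and> (1 \<^bold>\<in> 0 \<^bold>\<or> 1 \<^bold>= 0))))"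

definition indiscernibility :: "nat \<Rightarrow> fm \<Rightarrow> fm" where
  "indiscernibility n p = (let xs = [n..<2 * n]; ys = [0..<n] in
    Alls n (Alls n (IncrI xs \<^bold>\<and> IncrI ys \<^bold>\<longrightarrow> (app p xs \<^bold>\<longleftrightarrow> app p ys))))"

definition Indis :: "sym set \<Rightarrow> fm set" where
  "Indis L = {indiscernibility n p | n p. p \<in> formulas L n}"

definition ZFI :: "fm set" where
  "ZFI = ZF {} \<union> Coll {ISym} \<union> {Cof} \<union> Indis {}"

definition ZFI_less :: "fm set" where
  "ZFI_less = ZF {LessSym} \<union> {GW} \<union> Coll {LessSym, ISym} \<union> {Cof} \<union> Indis {LessSym}"

section \<open>Apartness and diagonal indiscernibility\<close>

text \<open>
  Arguments of \<open>p\<close>: \<open>x\<^sub>1, \<dots>, x\<^sub>n, y\<close>. Below the quantifiers \<open>\<forall>i \<forall>j\<close> and \<open>\<forall>x\<^sub>n \<dots> \<forall>x\<^sub>1\<close>, the variables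
  \<open>x\<^sub>1, \<dots>, x\<^sub>n, j, i\<close> are \<open>0, \<dots>, n - 1, n, n + 1\<close>. The order of the ordinals \<open>i, j\<close> is membership,
  not the symbol \<open><\<close>.
\<close>
definition apartness :: "nat \<Rightarrow> fm \<Rightarrow> fm" where
  "apartness n p = All (All (InI 1 \<^bold>\<and> InI 0 \<^bold>\<and> 1 \<^bold>\<in> 0 \<^bold>\<longrightarrow>
    Alls n (Conj (map (\<lambda>x. InV x (n + 1)) [0..<n]) \<^bold>\<longrightarrow>
      Ex (app p ([1..<n + 1] @ [0])) \<^bold>\<longrightarrow>
      Ex (InV 0 (n + 1) \<^bold>\<and> app p ([1..<n + 1] @ [0])))))"

text \<open>
  Arguments of \<open>p\<close>: \<open>x\<^sub>1, \<dots>, x\<^sub>n, i, j\<^sub>1, \<dots>, j\<^sub>r\<close>. Below the quantifiers over \<open>i\<close>, the \<open>j\<close>'s and the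
  \<open>k\<close>'s, the variables are \<open>i = 2r\<close>, \<open>j\<^sub>m\<^sub>+\<^sub>1 = r + m\<close>, \<open>k\<^sub>m\<^sub>+\<^sub>1 = m\<close>; the quantifiers over the \<open>x\<close>'s
  shift them by \<open>n\<close>.
\<close>
definition diagonal_indis :: "nat \<Rightarrow> nat \<Rightarrow> fm \<Rightarrow> fm" where
  "diagonal_indis n r p = All (Alls r (Alls r
    (InI (2 * r) \<^bold>\<and> IncrI [r..<2 * r] \<^bold>\<and> IncrI [0..<r] \<^bold>\<and> 2 * r \<^bold>\<in> r \<^bold>\<and> 2 * r \<^bold>\<in> 0 \<^bold>\<longrightarrow>
      Alls n (Conj (map (\<lambda>x. InV x (2 * r + n)) [0..<n]) \<^bold>\<longrightarrow>
        (app p ([0..<n] @ [2 * r + n] @ [r + n..<2 * r + n]) \<^bold>\<longleftrightarrow>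
         app p ([0..<n] @ [2 * r + n] @ [n..<r + n]))))))"

end

theory Submission
  imports Defs "HOL-Library.Countable_Set"
begin

text \<open>
  By the completeness theorem it suffices to argue in a model of the theory. By indiscernibility,
  a formula holds of all increasing tuples from \<open>I\<close> as soon as it holds of one.

  Apartness: given \<open>i \<in> I\<close>, collection bounds witnesses for all tuples from \<open>V(i)\<close> by some \<open>V(c)\<close>,
  and cofinality of \<open>I\<close> gives one \<open>j \<in> I\<close> above \<open>i\<close> and \<open>c\<close>.

  Diagonal indiscernibility: it suffices to compare \<open>j\<^sub>1 < \<dots> < j\<^sub>r\<close> with a tuple \<open>k\<^sub>1 < \<dots> < k\<^sub>r\<close>
  above it, so by indiscernibility to find, for one \<open>i\<close>, one such pair \<open>j, k\<close> that agrees on \<open>V(i)\<close>.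
  Every tuple from \<open>I\<close> above \<open>i\<close> defines a subset of a set \<open>t\<close> of codes for \<open>V(i)\<^sup>n\<close>. Collection
  for formulae with \<open>I\<close>, applied to the power set of \<open>t\<close>, yields a bound \<open>b\<close> such that each subset
  defined by some tuple is defined by one below \<open>b\<close>. Take \<open>k\<close> above \<open>b\<close>, and \<open>j\<close> below \<open>b\<close> with the
  same subset.
\<close>

section \<open>Renaming\<close>

abbreviation lift :: "(nat \<Rightarrow> nat) \<Rightarrow> nat \<Rightarrow> nat" where
  "lift f \<equiv> \<lambda>v. case v of 0 \<Rightarrow> 0 | Suc m \<Rightarrow> Suc (f m)"

lemma lift_comp: "lift f \<circ> lift g = lift (f \<circ> g)"
  by (auto simp: fun_eq_iff split: nat.split)

lemma lift_id: "lift (\<lambda>v. v) = (\<lambda>v. v)"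
  by (auto simp: fun_eq_iff split: nat.split)

lemma rename_rename: "rename f (rename g p) = rename (f \<circ> g) p"
  by (induction p arbitrary: f g) (simp_all add: lift_comp)

lemma rename_id: "rename (\<lambda>v. v) p = p"
  by (induction p) (simp_all add: lift_id)

lemma rename_cong: "(\<And>v. v \<in> fv p \<Longrightarrow> f v = g v) \<Longrightarrow> rename f p = rename g p"
proof (induction p arbitrary: f g)
  case (All p)
  have "rename (lift f) p = rename (lift g) p"
    by (rule All.IH) (use All.prems in \<open>auto split: nat.split\<close>)
  then show ?case by simp
next
  case (Imp p q)
  have "rename f p = rename g p" "rename f q = rename g q"
    by (rule Imp.IH, use Imp.prems in auto)+
  then show ?case by simp
qed auto

lemma rename_sentence: "p \<in> formulas L 0 \<Longrightarrow> rename f p = p"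
  using rename_cong[of p f "\<lambda>v. v"] by (simp add: formulas_def rename_id)

lemma syms_rename [simp]: "syms (rename f p) = syms p"
  by (induction p arbitrary: f) simp_all

lemma syms_inst [simp]: "syms (inst p t) = syms p"
  by (simp add: inst_def)

lemma syms_Neg [simp]: "syms (Neg p) = syms p"
  by (simp add: Neg_def)

lemma fv_Neg [simp]: "fv (Neg p) = fv p"
  by (simp add: Neg_def)

lemma fv_rename: "fv (rename f p) = f ` fv p"
proof (induction p arbitrary: f)
  case (All p)
  have "{v. Suc v \<in> lift f ` fv p} = f ` {v. Suc v \<in> fv p}"
  proof (intro equalityI subsetI)
    fix v assume "v \<in> {v. Suc v \<in> lift f ` fv p}"
    then obtain u where "u \<in> fv p" "Suc v = lift f u" by auto
    then show "v \<in> f ` {v. Suc v \<in> fv p}" by (cases u) auto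
  qed force
  then show ?case by (simp add: All)
qed auto

lemma finite_fv: "finite (fv p)"
proof (induction p)
  case (All p)
  have "Suc ` {v. Suc v \<in> fv p} \<subseteq> fv p" by auto
  then have "finite (Suc ` {v. Suc v \<in> fv p})" using All finite_subset by blast
  then show ?case by (simp add: finite_image_iff)
qed auto

lemma rename_inst: "rename f (inst p t) = inst (rename (lift f) p) (f t)"
  unfolding inst_def rename_rename
  by (rule arg_cong[where f = "\<lambda>h. rename h p"]) (auto simp: fun_eq_iff split: nat.split)

lemma inst_rename_lift: "inst (rename (lift f) p) t = rename (case_nat t f) p"
  unfolding inst_def rename_rename
  by (rule arg_cong[where f = "\<lambda>h. rename h p"]) (auto simp: fun_eq_iff split: nat.split)

section \<open>Derivability and consistency\<close>

lemma derives_weaken: "derives L \<Gamma> p \<Longrightarrow> \<Gamma> \<subseteq> \<Delta> \<Longrightarrow> derives L \<Delta> p"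
proof (induction arbitrary: \<Delta> rule: derives.induct)
  case (ImpI p \<Gamma> q)
  then show ?case by (meson derives.ImpI insert_mono)
next
  case (Contr p \<Gamma>)
  then show ?case by (meson derives.Contr insert_mono)
next
  case (AllI \<Gamma> p)
  then show ?case by (meson derives.AllI image_mono)
qed (blast intro: derives.intros)+

lemma derives_rename: "derives L \<Gamma> p \<Longrightarrow> derives L (rename f ` \<Gamma>) (rename f p)"
proof (induction arbitrary: f rule: derives.induct)
  case (AllI \<Gamma> p)
  have "rename (lift f) ` rename Suc ` \<Gamma> = rename Suc ` rename f ` \<Gamma>"
    by (simp add: image_image rename_rename comp_def)
  then show ?case using AllI.IH[of "lift f"] by (auto intro: derives.AllI)
next
  case (AllE \<Gamma> p t)
  then show ?case using derives.AllE[of L "rename f ` \<Gamma>" "rename (lift f) p"]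
    by (simp add: rename_inst)
next
  case (EqSubst \<Gamma> a b p)
  then show ?case using derives.EqSubst[of L "rename f ` \<Gamma>" "f a" "f b" "rename (lift f) p"]
    by (simp add: rename_inst)
next
  case (Contr p \<Gamma>)
  show ?case by (rule derives.Contr) (use Contr in \<open>simp_all add: Neg_def\<close>)
next
  case (ImpI p \<Gamma> q)
  then show ?case by (simp add: derives.ImpI)
next
  case (ImpE \<Gamma> p q)
  then show ?case using derives.ImpE[of L "rename f ` \<Gamma>" "rename f p"] by simp
qed (simp_all add: derives.Assm derives.EqRefl)

lemma derives_finite: "derives L \<Gamma> p \<Longrightarrow> \<exists>\<Delta>. finite \<Delta> \<and> \<Delta> \<subseteq> \<Gamma> \<and> derives L \<Delta> p"
proof (induction rule: derives.induct)
  case (Assm p \<Gamma>)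
  then show ?case by (intro exI[of _ "{p}"]) (auto intro: derives.Assm)
next
  case (ImpI p \<Gamma> q)
  then obtain \<Delta> where finite_derivation: "finite \<Delta>" "\<Delta> \<subseteq> insert p \<Gamma>" "derives L \<Delta> q" by blast
  then have "derives L (insert p (\<Delta> - {p})) q" by (auto intro: derives_weaken)
  then show ?case
    using finite_derivation ImpI.hyps by (intro exI[of _ "\<Delta> - {p}"]) (auto intro: derives.ImpI)
next
  case (ImpE \<Gamma> p q)
  then obtain \<Delta> \<Delta>' where "finite \<Delta>" "\<Delta> \<subseteq> \<Gamma>" "derives L \<Delta> (p \<^bold>\<longrightarrow> q)"
    "finite \<Delta>'" "\<Delta>' \<subseteq> \<Gamma>" "derives L \<Delta>' p" by blast
  then show ?case
    by (intro exI[of _ "\<Delta> \<union> \<Delta>'"]) (auto intro: derives.ImpE[of _ _ p] derives_weaken)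
next
  case (Contr p \<Gamma>)
  then obtain \<Delta> where finite_derivation: "finite \<Delta>" "\<Delta> \<subseteq> insert (Neg p) \<Gamma>" "derives L \<Delta> Bot"
    by blast
  then have "derives L (insert (Neg p) (\<Delta> - {Neg p})) Bot" by (auto intro: derives_weaken)
  then show ?case using finite_derivation Contr.hyps
    by (intro exI[of _ "\<Delta> - {Neg p}"]) (auto intro: derives.Contr)
next
  case (AllI \<Gamma> p)
  then obtain \<Delta> where finite_derivation: "finite \<Delta>" "\<Delta> \<subseteq> rename Suc ` \<Gamma>" "derives L \<Delta> p" by blast
  then obtain \<Gamma>' where "\<Gamma>' \<subseteq> \<Gamma>" "finite \<Gamma>'" "\<Delta> = rename Suc ` \<Gamma>'"
    using finite_subset_image by metis
  then show ?case using finite_derivation by (intro exI[of _ \<Gamma>']) (auto intro: derives.AllI)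
next
  case (EqRefl \<Gamma> a)
  then show ?case by (intro exI[of _ "{}"]) (auto intro: derives.EqRefl)
next
  case (EqSubst \<Gamma> a b p)
  then obtain \<Delta> \<Delta>' where "finite \<Delta>" "\<Delta> \<subseteq> \<Gamma>" "derives L \<Delta> (a \<^bold>= b)"
    "finite \<Delta>'" "\<Delta>' \<subseteq> \<Gamma>" "derives L \<Delta>' (inst p a)" by blast
  then show ?case
    by (intro exI[of _ "\<Delta> \<union> \<Delta>'"]) (auto intro: derives.EqSubst[of _ _ a] derives_weaken)
qed (blast intro: derives.AllE)

lemma derives_generalize:
  assumes "derives L \<Gamma> (inst p t)" and fresh: "\<And>q. q \<in> \<Gamma> \<Longrightarrow> t \<notin> fv q" "t \<notin> fv (All p)"
  shows "derives L \<Gamma> (All p)"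
proof (rule derives.AllI)
  let ?f = "\<lambda>v. if v = t then 0 else Suc v"
  have "rename ?f q = rename Suc q" if "q \<in> \<Gamma>" for q
    using fresh(1)[OF that] by (intro rename_cong) auto
  then have "rename ?f ` \<Gamma> = rename Suc ` \<Gamma>" by (rule image_cong[OF refl])
  moreover have "rename ?f (inst p t) = rename (\<lambda>v. v) p"
    unfolding inst_def rename_rename
    by (rule rename_cong) (use fresh(2) in \<open>auto split: nat.split\<close>)
  ultimately show "derives L (rename Suc ` \<Gamma>) p"
    using derives_rename[OF assms(1), of ?f] by (simp add: rename_id)
qed

definition consistent :: "sym set \<Rightarrow> fm set \<Rightarrow> bool" where
  "consistent L \<Gamma> \<longleftrightarrow> \<not> derives L \<Gamma> Bot"

lemma consistent_subset: "consistent L \<Delta> \<Longrightarrow> \<Gamma> \<subseteq> \<Delta> \<Longrightarrow> consistent L \<Gamma>"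
  unfolding consistent_def using derives_weaken by blast

lemma derives_if_inconsistent_Neg:
  "\<not> consistent L (insert (Neg p) \<Gamma>) \<Longrightarrow> syms p \<subseteq> L \<Longrightarrow> derives L \<Gamma> p"
  by (simp add: consistent_def derives.Contr)

lemma derives_Neg_if_inconsistent:
  "\<not> consistent L (insert p \<Gamma>) \<Longrightarrow> syms p \<subseteq> L \<Longrightarrow> derives L \<Gamma> (Neg p)"
  by (simp add: consistent_def Neg_def derives.ImpI)

lemma inconsistent_if_derives_Neg: "derives L \<Gamma> p \<Longrightarrow> derives L \<Gamma> (Neg p) \<Longrightarrow> \<not> consistent L \<Gamma>"
  unfolding consistent_def Neg_def using derives.ImpE by blast

lemma consistent_UN:
  assumes "mono F" and "\<And>n :: nat. consistent L (F n)"
  shows "consistent L (\<Union>n. F n)"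
  unfolding consistent_def
proof
  assume "derives L (\<Union>n. F n) Bot"
  from derives_finite[OF this]
  obtain \<Delta> where finite_derivation: "finite \<Delta>" "\<Delta> \<subseteq> \<Union> (range F)" "derives L \<Delta> Bot" by blast
  have "subset.chain UNIV (range F)"
    unfolding subset.chain_def using monoD[OF assms(1)] nat_le_linear by blast
  then obtain n where "\<Delta> \<subseteq> F n"
    using finite_subset_Union_chain[OF finite_derivation(1,2)] by blast
  then show False
    using assms(2)[of n] derives_weaken[OF finite_derivation(3)] by (auto simp: consistent_def)
qed

lemma consistent_insert_witness:
  assumes "consistent L \<Gamma>" "Neg (All q) \<in> \<Gamma>" "syms q \<subseteq> L" and fresh: "\<And>p. p \<in> \<Gamma> \<Longrightarrow> t \<notin> fv p"
  shows "consistent L (insert (Neg (inst q t)) \<Gamma>)"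
proof (rule ccontr)
  assume "\<not> consistent L (insert (Neg (inst q t)) \<Gamma>)"
  then have "derives L \<Gamma> (inst q t)"
    by (rule derives_if_inconsistent_Neg) (simp add: assms)
  moreover have "t \<notin> fv (All q)" using fresh[OF assms(2)] by simp
  ultimately have "derives L \<Gamma> (All q)" using fresh by (intro derives_generalize)
  then show False using inconsistent_if_derives_Neg derives.Assm assms(1,2) by blast
qed

section \<open>Henkin sets\<close>

locale henkin_set =
  fixes L :: "sym set" and H :: "fm set"
  assumes consistent: "consistent L H"
    and maximal: "syms p \<subseteq> L \<Longrightarrow> consistent L (insert p H) \<Longrightarrow> p \<in> H"
    and witness: "syms p \<subseteq> L \<Longrightarrow> Neg (All p) \<in> H \<Longrightarrow> \<exists>t. Neg (inst p t) \<in> H"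

instance fm :: countable
  by countable_datatype

definition decides :: "sym set \<Rightarrow> fm \<Rightarrow> fm set \<Rightarrow> bool" where
  "decides L p \<Gamma> \<longleftrightarrow> (syms p \<subseteq> L \<longrightarrow> consistent L (insert p \<Gamma>) \<longrightarrow>
    p \<in> \<Gamma> \<and> (\<forall>q. p = Neg (All q) \<longrightarrow> (\<exists>t. Neg (inst q t) \<in> \<Gamma>)))"

lemma consistent_extend:
  assumes "consistent L \<Gamma>" "finite (\<Union> (fv ` \<Gamma>))"
  shows "\<exists>\<Delta>. \<Gamma> \<subseteq> \<Delta> \<and> consistent L \<Delta> \<and> finite (\<Union> (fv ` \<Delta>)) \<and> decides L p \<Delta>"
proof (cases "syms p \<subseteq> L \<and> consistent L (insert p \<Gamma>)")
  case False
  then have "decides L p \<Gamma>" by (auto simp: decides_def)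
  then show ?thesis using assms by blast
next
  case p_consistent: True
  have finite: "finite (\<Union> (fv ` insert q (insert p \<Gamma>)))" for q using assms(2) finite_fv by simp
  show ?thesis
  proof (cases "\<exists>q. p = Neg (All q)")
    case False
    then show ?thesis
      using p_consistent finite[of p] by (intro exI[of _ "insert p \<Gamma>"]) (auto simp: decides_def)
  next
    case True
    then obtain q where p_eq: "p = Neg (All q)" by blast
    obtain t where fresh: "\<And>r. r \<in> insert p \<Gamma> \<Longrightarrow> t \<notin> fv r"
      using ex_new_if_finite[OF infinite_UNIV_nat finite[of p]] by auto
    have "consistent L (insert (Neg (inst q t)) (insert p \<Gamma>))"
      by (rule consistent_insert_witness) (use p_consistent p_eq fresh in auto)
    then show ?thesis
      using finite[of "Neg (inst q t)"] p_eq
      by (intro exI[of _ "insert (Neg (inst q t)) (insert p \<Gamma>)"]) (auto simp: decides_def Neg_def)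
  qed
qed

theorem henkin_set_exists:
  assumes "consistent L \<Gamma>" "finite (\<Union> (fv ` \<Gamma>))"
  shows "\<exists>H. \<Gamma> \<subseteq> H \<and> henkin_set L H"
proof -
  have "\<exists>F. \<forall>n. (\<Gamma> \<subseteq> F n \<and> consistent L (F n) \<and> finite (\<Union> (fv ` F n))) \<and>
    F n \<subseteq> F (Suc n) \<and> decides L (from_nat n) (F (Suc n))"
    by (rule dependent_nat_choice) (use assms consistent_extend in \<open>blast, metis order_trans\<close>)
  then obtain F where chain: "\<And>n. \<Gamma> \<subseteq> F n" "\<And>n. consistent L (F n)" "\<And>n. F n \<subseteq> F (Suc n)"
    "\<And>n. decides L (from_nat n) (F (Suc n))" by blast
  let ?H = "\<Union>n. F n"
  have "henkin_set L ?H"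
  proof
    show "consistent L ?H"
      using chain(2,3) by (intro consistent_UN) (simp_all add: mono_iff_le_Suc)
    have stage: "p \<in> F (Suc (to_nat p)) \<and>
        (\<forall>q. p = Neg (All q) \<longrightarrow> (\<exists>t. Neg (inst q t) \<in> F (Suc (to_nat p))))"
      if "syms p \<subseteq> L" "consistent L (insert p ?H)" for p
    proof -
      have "consistent L (insert p (F (Suc (to_nat p))))"
        by (rule consistent_subset[OF that(2)]) blast
      then show ?thesis using chain(4)[of "to_nat p"] that(1) by (simp add: decides_def)
    qed
    show "p \<in> ?H" if "syms p \<subseteq> L" "consistent L (insert p ?H)" for p
      using stage[OF that] by blast
    show "\<exists>t. Neg (inst q t) \<in> ?H" if "syms q \<subseteq> L" "Neg (All q) \<in> ?H" for q
    proof -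
      have "consistent L (insert (Neg (All q)) ?H)"
        using \<open>consistent L ?H\<close> insert_absorb[OF that(2)] by simp
      then show ?thesis using stage[of "Neg (All q)"] that(1) by simp blast
    qed
  qed
  then show ?thesis using chain(1) by blast
qed

context henkin_set
begin

lemma mem_iff_derives:
  assumes "syms p \<subseteq> L" shows "p \<in> H \<longleftrightarrow> derives L H p"
proof
  assume "derives L H p"
  then have "consistent L (insert p H)"
    using consistent derives_Neg_if_inconsistent inconsistent_if_derives_Neg assms by blast
  then show "p \<in> H" by (rule maximal[OF assms])
qed (rule derives.Assm)

lemma Neg_mem_iff:
  assumes "syms p \<subseteq> L" shows "Neg p \<in> H \<longleftrightarrow> p \<notin> H"
proof
  assume "Neg p \<in> H"
  then show "p \<notin> H" using consistent inconsistent_if_derives_Neg derives.Assm by blast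
next
  assume "p \<notin> H"
  then show "Neg p \<in> H"
    using maximal derives_Neg_if_inconsistent mem_iff_derives assms syms_Neg by metis
qed

lemma Bot_not_mem: "Bot \<notin> H"
  using consistent derives.Assm unfolding consistent_def by blast

lemma Imp_mem_iff:
  assumes "syms p \<subseteq> L" "syms q \<subseteq> L" shows "(p \<^bold>\<longrightarrow> q) \<in> H \<longleftrightarrow> (p \<in> H \<longrightarrow> q \<in> H)"
proof
  assume "(p \<^bold>\<longrightarrow> q) \<in> H"
  then show "p \<in> H \<longrightarrow> q \<in> H"
    using mem_iff_derives[OF assms(2)] derives.ImpE derives.Assm by blast
next
  assume imp: "p \<in> H \<longrightarrow> q \<in> H"
  have "derives L (insert p H) q"
  proof (cases "q \<in> H")
    case True
    then show ?thesis by (auto intro: derives.Assm)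
  next
    case False
    then have "Neg p \<in> H" using imp Neg_mem_iff[OF assms(1)] by blast
    then have "\<not> consistent L (insert (Neg q) (insert p H))"
      by (intro inconsistent_if_derives_Neg[of _ _ p] derives.Assm) auto
    then show ?thesis using assms(2) by (rule derives_if_inconsistent_Neg)
  qed
  then show "(p \<^bold>\<longrightarrow> q) \<in> H" using assms by (simp add: mem_iff_derives derives.ImpI)
qed

lemma All_mem_iff:
  assumes "syms p \<subseteq> L" shows "All p \<in> H \<longleftrightarrow> (\<forall>t. inst p t \<in> H)"
proof
  show "All p \<in> H \<Longrightarrow> \<forall>t. inst p t \<in> H"
    using mem_iff_derives[of "inst p _"] assms derives.AllE[OF derives.Assm] by simp
next
  assume "\<forall>t. inst p t \<in> H"
  then have "Neg (inst p t) \<notin> H" for t using Neg_mem_iff[of "inst p t"] assms by simp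
  then show "All p \<in> H" using witness[OF assms] Neg_mem_iff[of "All p"] assms by auto
qed

lemma Eq_mem_refl: "(a \<^bold>= a) \<in> H"
  by (simp add: mem_iff_derives derives.EqRefl)

lemma Eq_mem_subst:
  assumes "(a \<^bold>= b) \<in> H" "inst p a \<in> H" "syms p \<subseteq> L" shows "inst p b \<in> H"
  using derives.EqSubst[of L H a b p] assms mem_iff_derives[of "inst p b"] derives.Assm by simp

lemma Eq_mem_sym: "(a \<^bold>= b) \<in> H \<Longrightarrow> (b \<^bold>= a) \<in> H"
  using Eq_mem_subst[of a b "0 \<^bold>= Suc a"] Eq_mem_refl by (simp add: inst_def)

lemma Eq_mem_trans: "(a \<^bold>= b) \<in> H \<Longrightarrow> (b \<^bold>= c) \<in> H \<Longrightarrow> (a \<^bold>= c) \<in> H"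
  using Eq_mem_subst[of b c "Suc a \<^bold>= 0"] by (simp add: inst_def)

end

section \<open>Semantics\<close>

definition scons :: "'a \<Rightarrow> (nat \<Rightarrow> 'a) \<Rightarrow> nat \<Rightarrow> 'a"  (infixr "\<cdot>" 65) where
  "x \<cdot> e = case_nat x e"

lemma scons_simps [simp]:
  "(x \<cdot> e) 0 = x" "(x \<cdot> e) (Suc n) = e n"
  "(x \<cdot> e) (numeral k) = e (pred_numeral k)" "(x \<cdot> e) (n + numeral k) = e (n + pred_numeral k)"
  by (simp_all add: scons_def numeral_eq_Suc)

lemma scons_lift: "(\<lambda>v. (x \<cdot> e) (lift f v)) = x \<cdot> (\<lambda>v. e (f v))"
  by (auto simp: fun_eq_iff scons_def split: nat.split)

lemma comp_scons: "h \<circ> (x \<cdot> e) = h x \<cdot> (h \<circ> e)"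
  by (auto simp: fun_eq_iff scons_def split: nat.split)

text \<open>
  \<open>Q\<close> interprets equality, so that the term model can be used before factoring out provable
  equality.
\<close>

primrec sat_eq ::
  "('a \<Rightarrow> 'a \<Rightarrow> bool) \<Rightarrow> ('a \<Rightarrow> 'a \<Rightarrow> bool) \<Rightarrow> ('a \<Rightarrow> 'a \<Rightarrow> bool) \<Rightarrow> ('a \<Rightarrow> bool) \<Rightarrow> (nat \<Rightarrow> 'a) \<Rightarrow> fm \<Rightarrow> bool"
  where
  "sat_eq Q E R I e (a \<^bold>= b) = Q (e a) (e b)"
| "sat_eq Q E R I e (a \<^bold>\<in> b) = E (e a) (e b)"
| "sat_eq Q E R I e (a \<^bold>< b) = R (e a) (e b)"
| "sat_eq Q E R I e (InI a) = I (e a)"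
| "sat_eq Q E R I e Bot = False"
| "sat_eq Q E R I e (p \<^bold>\<longrightarrow> q) = (sat_eq Q E R I e p \<longrightarrow> sat_eq Q E R I e q)"
| "sat_eq Q E R I e (All p) = (\<forall>x. sat_eq Q E R I (x \<cdot> e) p)"

lemma sat_Neg [simp]: "sat_eq Q E R I e (Neg p) = (\<not> sat_eq Q E R I e p)"
  by (simp add: Neg_def)

lemma sat_Top [simp]: "sat_eq Q E R I e Top"
  by (simp add: Top_def)

lemma sat_Or [simp]: "sat_eq Q E R I e (p \<^bold>\<or> q) = (sat_eq Q E R I e p \<or> sat_eq Q E R I e q)"
  by (auto simp: Or_def)

lemma sat_And [simp]: "sat_eq Q E R I e (p \<^bold>\<and> q) = (sat_eq Q E R I e p \<and> sat_eq Q E R I e q)"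
  by (auto simp: And_def)

lemma sat_Iff [simp]: "sat_eq Q E R I e (p \<^bold>\<longleftrightarrow> q) = (sat_eq Q E R I e p = sat_eq Q E R I e q)"
  by (auto simp: Iff_def)

lemma sat_Ex [simp]: "sat_eq Q E R I e (Ex p) = (\<exists>x. sat_eq Q E R I (x \<cdot> e) p)"
  by (simp add: Ex_def)

lemma sat_BAll [simp]:
  "sat_eq Q E R I e (BAll v p) = (\<forall>x. E x (e v) \<longrightarrow> sat_eq Q E R I (x \<cdot> e) p)"
  by (simp add: BAll_def)

lemma sat_BEx [simp]:
  "sat_eq Q E R I e (BEx v p) = (\<exists>x. E x (e v) \<and> sat_eq Q E R I (x \<cdot> e) p)"
  by (simp add: BEx_def)

lemma sat_Conj [simp]: "sat_eq Q E R I e (Conj ps) = (\<forall>p \<in> set ps. sat_eq Q E R I e p)"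
  by (induction ps) (simp_all add: Conj_def)

lemma sat_rename: "sat_eq Q E R I e (rename f p) = sat_eq Q E R I (\<lambda>v. e (f v)) p"
  by (induction p arbitrary: e f) (simp_all add: scons_lift)

lemma sat_cong:
  "(\<And>v. v \<in> fv p \<Longrightarrow> e v = e' v) \<Longrightarrow> sat_eq Q E R I e p = sat_eq Q E R I e' p"
proof (induction p arbitrary: e e')
  case (All p)
  have "sat_eq Q E R I (x \<cdot> e) p = sat_eq Q E R I (x \<cdot> e') p" for x
    by (rule All.IH) (use All.prems in \<open>auto simp: scons_def split: nat.split\<close>)
  then show ?case by simp
next
  case (Imp p q)
  have "sat_eq Q E R I e p = sat_eq Q E R I e' p"
    by (rule Imp.IH(1)) (use Imp.prems in auto)
  moreover have "sat_eq Q E R I e q = sat_eq Q E R I e' q"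
    by (rule Imp.IH(2)) (use Imp.prems in auto)
  ultimately show ?case by simp
qed auto

lemma sat_surj_hom:
  assumes "surj h" and "\<And>x y. Q' (h x) (h y) = Q x y" "\<And>x y. E' (h x) (h y) = E x y"
    and "\<And>x y. R' (h x) (h y) = R x y" "\<And>x. I' (h x) = I x"
  shows "sat_eq Q' E' R' I' (h \<circ> e) p = sat_eq Q E R I e p"
proof (induction p arbitrary: e)
  case (All p)
  have "(\<forall>y. sat_eq Q' E' R' I' (y \<cdot> (h \<circ> e)) p) = (\<forall>x. sat_eq Q' E' R' I' (h x \<cdot> (h \<circ> e)) p)"
    using assms(1) by (metis surjD)
  then show ?case unfolding sat_eq.simps comp_scons[symmetric] All .
qed (simp_all add: assms)

section \<open>Completeness\<close>

locale congruence_structure =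
  fixes Q E R :: "'a \<Rightarrow> 'a \<Rightarrow> bool" and I :: "'a \<Rightarrow> bool"
  assumes equivp: "equivp Q"
    and E_cong: "Q x x' \<Longrightarrow> Q y y' \<Longrightarrow> E x y \<Longrightarrow> E x' y'"
    and R_cong: "Q x x' \<Longrightarrow> Q y y' \<Longrightarrow> R x y \<Longrightarrow> R x' y'"
    and I_cong: "Q x x' \<Longrightarrow> I x \<Longrightarrow> I x'"
begin

lemma class_eq_iff: "Q x = Q y \<longleftrightarrow> Q x y"
  using equivp unfolding equivp_def by blast

lemma E_iff: "Q x x' \<Longrightarrow> Q y y' \<Longrightarrow> E x y \<longleftrightarrow> E x' y'"
  using E_cong equivp_symp[OF equivp] by blast

lemma R_iff: "Q x x' \<Longrightarrow> Q y y' \<Longrightarrow> R x y \<longleftrightarrow> R x' y'"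
  using R_cong equivp_symp[OF equivp] by blast

lemma I_iff: "Q x x' \<Longrightarrow> I x \<longleftrightarrow> I x'"
  using I_cong equivp_symp[OF equivp] by blast

text \<open>Forming singletons is injective and misses the empty set.\<close>

lemma infinite_classes:
  assumes "\<And>e. sat_eq Q E R I e Pairing" "\<And>e. sat_eq Q E R I e Infinity"
  shows "infinite (range Q)"
proof
  assume finite: "finite (range Q)"
  note [simp] = class_eq_iff equivp_reflp[OF equivp]
  have "\<forall>x. \<exists>s. \<forall>z. E z s \<longleftrightarrow> Q z x"
    using assms(1) by (force simp: Pairing_def IsUPair_def)
  then obtain singleton where singleton: "\<And>x z. E z (singleton x) \<longleftrightarrow> Q z x" by metis
  obtain empty where empty: "\<And>z. \<not> E z empty"
    using assms(2)[of "\<lambda>_. undefined"] by (auto simp: Infinity_def Nonempty_def)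
  let ?class_singleton = "\<lambda>X. Q (singleton (inv Q X))"
  have rep: "Q (inv Q (Q x)) x" for x
    using f_inv_into_f[OF rangeI[of Q x]] by simp
  have "Q x y" if "Q (singleton x) (singleton y)" for x y
    using that E_iff[of x x "singleton x" "singleton y"] singleton by simp
  then have "inj_on ?class_singleton (range Q)"
    by (auto intro!: inj_onI) (metis rep class_eq_iff)
  moreover have "?class_singleton ` range Q \<subseteq> range Q" by auto
  ultimately have "?class_singleton ` range Q = range Q" using finite endo_inj_surj by metis
  then have "Q empty \<in> ?class_singleton ` range Q" by blast
  then obtain X where "Q empty = ?class_singleton X" by (rule imageE)
  then show False
    using E_iff[of "inv Q X" "inv Q X" empty "singleton (inv Q X)"] singleton empty by simp
qed

end

text \<open>
  The quotient is carried by all of \<open>nat\<close>, so satisfaction never has to be relativized to a domain.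
\<close>

lemma quotient_structure:
  fixes Q E R :: "'a :: countable \<Rightarrow> 'a \<Rightarrow> bool"
  assumes "congruence_structure Q E R I" and "infinite (range Q)"
  obtains h :: "'a \<Rightarrow> nat" and E' R' I'
  where "surj h" "\<And>e p. sat_eq (=) E' R' I' (h \<circ> e) p = sat_eq Q E R I e p"
proof -
  interpret congruence_structure Q E R I by fact
  have "countable (range Q)" by simp
  then obtain f :: "('a \<Rightarrow> bool) \<Rightarrow> nat" where bij_f: "bij_betw f (range Q) UNIV"
    using countableE_infinite assms(2) by metis
  define h where "h = f \<circ> Q"
  have "surj h" using bij_f unfolding h_def bij_betw_def image_comp[symmetric] by simp
  have h_eq_iff: "h x = h y \<longleftrightarrow> Q x y" for x y
    using inj_on_eq_iff[OF bij_betw_imp_inj_on[OF bij_f] rangeI rangeI, of x y]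
    by (simp add: h_def class_eq_iff)
  have rep: "Q (inv h (h x)) x" for x
    using surj_f_inv_f[OF \<open>surj h\<close>, of "h x"] h_eq_iff by blast
  let ?E = "\<lambda>x y. E (inv h x) (inv h y)" and ?R = "\<lambda>x y. R (inv h x) (inv h y)"
    and ?I = "\<lambda>x. I (inv h x)"
  have "sat_eq (=) ?E ?R ?I (h \<circ> e) p = sat_eq Q E R I e p" for e p
    using \<open>surj h\<close> by (rule sat_surj_hom)
      (simp_all add: h_eq_iff E_iff[OF rep rep] R_iff[OF rep rep] I_iff[OF rep])
  then show thesis by (rule that[OF \<open>surj h\<close>])
qed

context henkin_set
begin

definition term_eq :: "nat \<Rightarrow> nat \<Rightarrow> bool" where
  "term_eq a b \<longleftrightarrow> (a \<^bold>= b) \<in> H"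

definition term_mem :: "nat \<Rightarrow> nat \<Rightarrow> bool" where
  "term_mem a b \<longleftrightarrow> (a \<^bold>\<in> b) \<in> H"

definition term_less :: "nat \<Rightarrow> nat \<Rightarrow> bool" where
  "term_less a b \<longleftrightarrow> LessSym \<in> L \<and> (a \<^bold>< b) \<in> H"

definition term_I :: "nat \<Rightarrow> bool" where
  "term_I a \<longleftrightarrow> ISym \<in> L \<and> InI a \<in> H"

lemma term_structure: "congruence_structure term_eq term_mem term_less term_I"
proof
  show "equivp term_eq"
    by (intro equivpI reflpI sympI transpI)
      (auto simp: term_eq_def intro: Eq_mem_refl Eq_mem_sym Eq_mem_trans)
  show "term_mem a' b'" if "term_eq a a'" "term_eq b b'" "term_mem a b" for a a' b b'
    using that Eq_mem_subst[of a a' "0 \<^bold>\<in> Suc b"] Eq_mem_subst[of b b' "Suc a' \<^bold>\<in> 0"]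
    by (simp add: term_eq_def term_mem_def inst_def)
  show "term_less a' b'" if "term_eq a a'" "term_eq b b'" "term_less a b" for a a' b b'
    using that Eq_mem_subst[of a a' "0 \<^bold>< Suc b"] Eq_mem_subst[of b b' "Suc a' \<^bold>< 0"]
    by (simp add: term_eq_def term_less_def inst_def)
  show "term_I a'" if "term_eq a a'" "term_I a" for a a'
    using that Eq_mem_subst[of a a' "InI 0"] by (simp add: term_eq_def term_I_def inst_def)
qed

abbreviation term_sat :: "(nat \<Rightarrow> nat) \<Rightarrow> fm \<Rightarrow> bool" where
  "term_sat \<equiv> sat_eq term_eq term_mem term_less term_I"

lemma term_sat_iff: "syms p \<subseteq> L \<Longrightarrow> term_sat e p \<longleftrightarrow> rename e p \<in> H"
  by (induction p arbitrary: e)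
    (simp_all add: term_eq_def term_mem_def term_less_def term_I_def Bot_not_mem Imp_mem_iff
      All_mem_iff inst_rename_lift scons_def)

end

theorem congruence_completeness:
  assumes "\<Gamma> \<subseteq> formulas L 0" "syms p \<subseteq> L"
    and valid: "\<And>(Q :: nat \<Rightarrow> nat \<Rightarrow> bool) E R I e. congruence_structure Q E R I \<Longrightarrow>
      (\<And>q e. q \<in> \<Gamma> \<Longrightarrow> sat_eq Q E R I e q) \<Longrightarrow> sat_eq Q E R I e p"
  shows "derives L \<Gamma> p"
proof (rule ccontr)
  assume "\<not> derives L \<Gamma> p"
  then have "consistent L (insert (Neg p) \<Gamma>)" using derives_if_inconsistent_Neg assms(2) by blast
  moreover have "finite (\<Union> (fv ` insert (Neg p) \<Gamma>))"
  proof -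
    have "\<Union> (fv ` \<Gamma>) = {}" using assms(1) by (auto simp: formulas_def)
    then show ?thesis by (simp add: finite_fv)
  qed
  ultimately obtain H where henkin_H: "insert (Neg p) \<Gamma> \<subseteq> H" "henkin_set L H"
    using henkin_set_exists by meson
  interpret henkin_set L H by fact
  have "term_sat e q" if "q \<in> \<Gamma>" for q e
  proof -
    have "q \<in> formulas L 0" using assms(1) that by blast
    then show ?thesis
      using that henkin_H(1) by (auto simp: term_sat_iff rename_sentence formulas_def)
  qed
  then have "term_sat (\<lambda>v. v) p" by (rule valid[OF term_structure])
  then show False using henkin_H(1) assms(2) Neg_mem_iff by (simp add: term_sat_iff rename_id)
qed

theorem completeness:
  assumes "\<Gamma> \<subseteq> formulas L 0" "syms p \<subseteq> L" "Pairing \<in> \<Gamma>" "Infinity \<in> \<Gamma>"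
    and valid: "\<And>(E :: nat \<Rightarrow> nat \<Rightarrow> bool) R I e.
      (\<And>q e. q \<in> \<Gamma> \<Longrightarrow> sat_eq (=) E R I e q) \<Longrightarrow> sat_eq (=) E R I e p"
  shows "derives L \<Gamma> p"
proof (rule congruence_completeness[OF assms(1,2)])
  fix Q E R :: "nat \<Rightarrow> nat \<Rightarrow> bool" and I e
  assume congruence: "congruence_structure Q E R I" and axioms: "\<And>q e. q \<in> \<Gamma> \<Longrightarrow> sat_eq Q E R I e q"
  have "infinite (range Q)"
    using congruence_structure.infinite_classes[OF congruence] axioms assms(3,4) by blast
  then obtain h :: "nat \<Rightarrow> nat" and E' R' I' where quotient: "surj h"
    "\<And>e p. sat_eq (=) E' R' I' (h \<circ> e) p = sat_eq Q E R I e p"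
    using quotient_structure[OF congruence] by metis
  have "sat_eq (=) E' R' I' e q" if "q \<in> \<Gamma>" for q e
  proof -
    have "e = h \<circ> (inv h \<circ> e)" by (simp add: fun_eq_iff surj_f_inv_f[OF quotient(1)])
    then show ?thesis using quotient(2) axioms[OF that] by metis
  qed
  then show "sat_eq Q E R I e p" using valid quotient(2) by blast
qed

section \<open>Formulae of a language\<close>

lemma formulas_atomic [simp]:
  "(a \<^bold>= b) \<in> formulas L k \<longleftrightarrow> a < k \<and> b < k"
  "(a \<^bold>\<in> b) \<in> formulas L k \<longleftrightarrow> a < k \<and> b < k"
  "(a \<^bold>< b) \<in> formulas L k \<longleftrightarrow> LessSym \<in> L \<and> a < k \<and> b < k"
  "InI a \<in> formulas L k \<longleftrightarrow> ISym \<in> L \<and> a < k"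
  "Bot \<in> formulas L k"
  by (auto simp: formulas_def)

lemma formulas_Imp [simp]: "(p \<^bold>\<longrightarrow> q) \<in> formulas L k \<longleftrightarrow> p \<in> formulas L k \<and> q \<in> formulas L k"
  by (auto simp: formulas_def)

lemma formulas_All [simp]: "All p \<in> formulas L k \<longleftrightarrow> p \<in> formulas L (Suc k)"
  unfolding formulas_def
  by (auto simp: subset_iff) (metis less_Suc_eq_0_disj not0_implies_Suc Suc_less_eq)+

lemma formulas_connectives [simp]:
  "Neg p \<in> formulas L k \<longleftrightarrow> p \<in> formulas L k"
  "Top \<in> formulas L k"
  "(p \<^bold>\<or> q) \<in> formulas L k \<longleftrightarrow> p \<in> formulas L k \<and> q \<in> formulas L k"
  "(p \<^bold>\<and> q) \<in> formulas L k \<longleftrightarrow> p \<in> formulas L k \<and> q \<in> formulas L k"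
  "(p \<^bold>\<longleftrightarrow> q) \<in> formulas L k \<longleftrightarrow> p \<in> formulas L k \<and> q \<in> formulas L k"
  "Ex p \<in> formulas L k \<longleftrightarrow> p \<in> formulas L (Suc k)"
  "BAll v p \<in> formulas L k \<longleftrightarrow> v < k \<and> p \<in> formulas L (Suc k)"
  "BEx v p \<in> formulas L k \<longleftrightarrow> v < k \<and> p \<in> formulas L (Suc k)"
  by (auto simp: Neg_def Top_def Or_def And_def Iff_def Ex_def BAll_def BEx_def)

lemma formulas_Alls [simp]: "Alls n p \<in> formulas L k \<longleftrightarrow> p \<in> formulas L (n + k)"
  by (induction n arbitrary: k) (simp_all add: Alls_def)

lemma formulas_Conj [simp]: "Conj ps \<in> formulas L k \<longleftrightarrow> set ps \<subseteq> formulas L k"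
  by (induction ps) (simp_all add: Conj_def)

lemma formulas_set_notions [simp]:
  "Sub a b \<in> formulas L k \<longleftrightarrow> a < k \<and> b < k"
  "Nonempty a \<in> formulas L k \<longleftrightarrow> a < k"
  "IsSucc a b \<in> formulas L k \<longleftrightarrow> a < k \<and> b < k"
  "IsUPair c a b \<in> formulas L k \<longleftrightarrow> a < k \<and> b < k \<and> c < k"
  by (auto simp: Sub_def Nonempty_def IsSucc_def IsUPair_def)

lemma formulas_IsOPair [simp]: "IsOPair c a b \<in> formulas L k \<longleftrightarrow> a < k \<and> b < k \<and> c < k"
  by (auto simp: IsOPair_def)

lemma formulas_Maps [simp]: "Maps c a b \<in> formulas L k \<longleftrightarrow> a < k \<and> b < k \<and> c < k"
  by (auto simp: Maps_def)

lemma formulas_Ord [simp]: "Ord a \<in> formulas L k \<longleftrightarrow> a < k"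
  by (auto simp: Ord_def)

lemma formulas_IsV [simp]: "IsV a b \<in> formulas L k \<longleftrightarrow> a < k \<and> b < k"
  by (auto simp: IsV_def)

lemma formulas_InV [simp]: "InV a b \<in> formulas L k \<longleftrightarrow> a < k \<and> b < k"
  by (auto simp: InV_def)

lemma formulas_IncrI: "ISym \<in> L \<Longrightarrow> set vs \<subseteq> {..<k} \<Longrightarrow> IncrI vs \<in> formulas L k"
  by (induction vs rule: IncrI.induct) auto

lemma formulas_mono: "p \<in> formulas L k \<Longrightarrow> L \<subseteq> L' \<Longrightarrow> p \<in> formulas L' k"
  by (auto simp: formulas_def)

lemma formulas_rename:
  "p \<in> formulas L n \<Longrightarrow> (\<And>v. v < n \<Longrightarrow> f v < k) \<Longrightarrow> rename f p \<in> formulas L k"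
  by (auto simp: formulas_def fv_rename)

lemma formulas_app: "p \<in> formulas L (length vs) \<Longrightarrow> set vs \<subseteq> {..<k} \<Longrightarrow> app p vs \<in> formulas L k"
  unfolding app_def by (rule formulas_rename) (auto simp: subset_iff)

section \<open>Satisfaction by tuples\<close>

definition prepend :: "'a list \<Rightarrow> (nat \<Rightarrow> 'a) \<Rightarrow> nat \<Rightarrow> 'a"  (infixr "\<frown>" 65) where
  "xs \<frown> e = foldr (\<cdot>) xs e"

lemma prepend_simps [simp]: "[] \<frown> e = e" "(x # xs) \<frown> e = x \<cdot> (xs \<frown> e)"
  by (simp_all add: prepend_def)

lemma prepend_nth [simp]:
  "v < length xs \<Longrightarrow> (xs \<frown> e) v = xs ! v" "(xs \<frown> e) (length xs + v) = e v"
  by (induction xs arbitrary: v) (auto simp: nth_Cons split: nat.split)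

lemma prepend_nth_ge: "length xs \<le> v \<Longrightarrow> (xs \<frown> e) v = e (v - length xs)"
  using prepend_nth(2)[of xs e "v - length xs"] by simp

lemma map_scons_upt [simp]:
  "0 < a \<Longrightarrow> map (x \<cdot> e) [a..<b] = map e [a - 1..<b - 1]"
  by (rule nth_equalityI) (auto simp: scons_def split: nat.split)

lemma map_prepend_upt [simp]:
  "length xs \<le> a \<Longrightarrow> map (xs \<frown> e) [a..<b] = map e [a - length xs..<b - length xs]"
  "length xs = n \<Longrightarrow> map (xs \<frown> e) [0..<n] = xs"
  by (rule nth_equalityI; auto simp: prepend_nth_ge)+

lemma ball_upt [simp]: "(\<forall>m \<in> {0..<n}. P m) \<longleftrightarrow> (\<forall>m < n. P m)" for n :: nat
  by auto

lemma sat_Alls [simp]: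
  "sat_eq Q E R I e (Alls n p) \<longleftrightarrow> (\<forall>xs. length xs = n \<longrightarrow> sat_eq Q E R I (xs \<frown> e) p)"
proof (induction n arbitrary: p)
  case 0
  then show ?case by (simp add: Alls_def)
next
  case (Suc n)
  have "Alls (Suc n) p = Alls n (All p)" by (simp add: Alls_def funpow_swap1)
  moreover have "(\<forall>xs. length xs = Suc n \<longrightarrow> sat_eq Q E R I (xs \<frown> e) p) \<longleftrightarrow>
    (\<forall>xs. length xs = n \<longrightarrow> (\<forall>x. sat_eq Q E R I (x \<cdot> (xs \<frown> e)) p))"
    by (metis length_Suc_conv prepend_simps(2))
  ultimately show ?case using Suc[of "All p"] by simp
qed

locale membership_structure =
  fixes E :: "'a \<Rightarrow> 'a \<Rightarrow> bool"  (infix "\<epsilon>" 50)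
    and R :: "'a \<Rightarrow> 'a \<Rightarrow> bool" and I :: "'a \<Rightarrow> bool"
begin

abbreviation sat :: "(nat \<Rightarrow> 'a) \<Rightarrow> fm \<Rightarrow> bool" where
  "sat \<equiv> sat_eq (=) E R I"

definition holds :: "fm \<Rightarrow> 'a list \<Rightarrow> bool" where
  "holds p xs \<longleftrightarrow> sat (\<lambda>v. xs ! v) p"

lemma holds_iff_sat:
  "p \<in> formulas L (length xs) \<Longrightarrow> (\<And>v. v < length xs \<Longrightarrow> e v = xs ! v) \<Longrightarrow> holds p xs \<longleftrightarrow> sat e p"
  unfolding holds_def by (rule sat_cong) (auto simp: formulas_def)

lemma sat_app: "p \<in> formulas L (length vs) \<Longrightarrow> sat e (app p vs) \<longleftrightarrow> holds p (map e vs)"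
  by (subst holds_iff_sat[where L = L and e = "\<lambda>v. e (vs ! v)"]) (simp_all add: app_def sat_rename)

section \<open>Definability\<close>

text \<open>
  \<open>f\<close> assigns to each variable of the defining formula \<open>p\<close> an argument (\<open>Inl\<close>) or a parameter from
  \<open>A\<close> (\<open>Inr\<close>).
\<close>

definition definable :: "sym set \<Rightarrow> 'a set \<Rightarrow> ((nat \<Rightarrow> 'a) \<Rightarrow> bool) \<Rightarrow> bool" where
  "definable L A P \<longleftrightarrow>
    (\<exists>p f. syms p \<subseteq> L \<and> range f \<subseteq> UNIV <+> A \<and> (\<forall>e. P e \<longleftrightarrow> sat (case_sum e id \<circ> f) p))"

definition is_term :: "'a set \<Rightarrow> ((nat \<Rightarrow> 'a) \<Rightarrow> 'a) \<Rightarrow> bool" where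
  "is_term A t \<longleftrightarrow> (\<exists>u \<in> UNIV <+> A. t = (\<lambda>e. case_sum e id u))"

definition is_term_list :: "'a set \<Rightarrow> ((nat \<Rightarrow> 'a) \<Rightarrow> 'a list) \<Rightarrow> bool" where
  "is_term_list A t \<longleftrightarrow> (\<exists>us \<in> lists (UNIV <+> A). t = (\<lambda>e. map (case_sum e id) us))"

named_theorems definable_intros

lemma is_term_variable [definable_intros]: "is_term A (\<lambda>e. e v)"
  unfolding is_term_def by (rule bexI[of _ "Inl v"]) auto

lemma is_term_parameter [definable_intros]: "is_term UNIV (\<lambda>e. c)"
  unfolding is_term_def by (rule bexI[of _ "Inr c"]) auto

lemma is_term_list_Nil [definable_intros]: "is_term_list A (\<lambda>e. [])"
  unfolding is_term_list_def by (rule bexI[of _ "[]"]) auto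

lemma is_term_list_Cons [definable_intros]:
  assumes "is_term A t" "is_term_list A ts" shows "is_term_list A (\<lambda>e. t e # ts e)"
proof -
  obtain u us where "u \<in> UNIV <+> A" "t = (\<lambda>e. case_sum e id u)"
    "us \<in> lists (UNIV <+> A)" "ts = (\<lambda>e. map (case_sum e id) us)"
    using assms unfolding is_term_def is_term_list_def by blast
  then show ?thesis unfolding is_term_list_def by (intro bexI[of _ "u # us"]) auto
qed

lemma is_term_list_append [definable_intros]:
  assumes "is_term_list A ss" "is_term_list A ts" shows "is_term_list A (\<lambda>e. ss e @ ts e)"
proof -
  obtain us vs where "us \<in> lists (UNIV <+> A)" "ss = (\<lambda>e. map (case_sum e id) us)"
    "vs \<in> lists (UNIV <+> A)" "ts = (\<lambda>e. map (case_sum e id) vs)"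
    using assms unfolding is_term_list_def by blast
  then show ?thesis unfolding is_term_list_def by (intro bexI[of _ "us @ vs"]) auto
qed

lemma is_term_list_map [definable_intros]: "is_term_list A (\<lambda>e. map (\<lambda>v. e (f v)) vs)"
  unfolding is_term_list_def by (rule bexI[of _ "map (\<lambda>v. Inl (f v)) vs"]) (auto simp: comp_def)

lemma is_term_list_parameters [definable_intros]: "is_term_list UNIV (\<lambda>e. cs)"
  unfolding is_term_list_def by (rule bexI[of _ "map Inr cs"]) (auto simp: comp_def)

lemma is_term_nth:
  assumes "is_term_list A ts" "\<And>e. v < length (ts e)" shows "is_term A (\<lambda>e. ts e ! v)"
proof -
  obtain us where "us \<in> lists (UNIV <+> A)" "ts = (\<lambda>e. map (case_sum e id) us)"
    using assms(1) unfolding is_term_list_def by blast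
  then show ?thesis using assms(2) unfolding is_term_def by (intro bexI[of _ "us ! v"]) auto
qed

lemma definable_sat: "syms p \<subseteq> L \<Longrightarrow> definable L A (\<lambda>e. sat e p)"
  unfolding definable_def by (intro exI[of _ p] exI[of _ Inl]) (auto simp: comp_def)

lemma definable_mono: "definable L A P \<Longrightarrow> L \<subseteq> L' \<Longrightarrow> definable L' A P"
  unfolding definable_def by (meson order_trans)

lemma definable_subst:
  assumes "definable L A P" and terms: "\<And>v. is_term A (t v)"
  shows "definable L A (\<lambda>e. P (\<lambda>v. t v e))"
proof -
  obtain p f where p_defines: "syms p \<subseteq> L" "range f \<subseteq> UNIV <+> A"
    "\<And>e. P e \<longleftrightarrow> sat (case_sum e id \<circ> f) p"
    using assms(1) unfolding definable_def by blast
  obtain u where t_eq: "\<And>v. u v \<in> UNIV <+> A" "\<And>v. t v = (\<lambda>e. case_sum e id (u v))"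
    using terms unfolding is_term_def by metis
  have "case_sum (\<lambda>v. t v e) id \<circ> f = case_sum e id \<circ> (case_sum u Inr \<circ> f)" for e
    by (auto simp: fun_eq_iff t_eq(2) split: sum.split)
  moreover have "range (case_sum u Inr \<circ> f) \<subseteq> UNIV <+> A"
    using p_defines(2) t_eq(1) by (auto split: sum.split)
  ultimately show ?thesis
    unfolding definable_def p_defines(3)
    using p_defines(1) by (intro exI[of _ p] exI[of _ "case_sum u Inr \<circ> f"]) simp
qed

lemma definable_subst1:
  assumes "definable L A (\<lambda>e. P (e 0))" "is_term A s"
  shows "definable L A (\<lambda>e. P (s e))"
  by (rule definable_subst[OF assms(1), of "\<lambda>v. s"]) (rule assms)

lemma definable_subst2:
  assumes "definable L A (\<lambda>e. P (e 0) (e 1))" "is_term A s" "is_term A t"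
  shows "definable L A (\<lambda>e. P (s e) (t e))"
  using definable_subst[OF assms(1), of "\<lambda>v. if v = 0 then s else t"] assms(2,3) by simp

lemma definable_subst3:
  assumes "definable L A (\<lambda>e. P (e 0) (e 1) (e 2))" "is_term A s" "is_term A t" "is_term A u"
  shows "definable L A (\<lambda>e. P (s e) (t e) (u e))"
  using assms(2-4)
    definable_subst[OF assms(1), of "\<lambda>v. if v = 0 then s else if v = 1 then t else u"]
  by simp

lemma definable_mem [definable_intros]:
  "is_term A s \<Longrightarrow> is_term A t \<Longrightarrow> definable L A (\<lambda>e. s e \<epsilon> t e)"
  using definable_subst2[of L A "(\<epsilon>)"] definable_sat[of "0 \<^bold>\<in> 1" L A] by simp

lemma definable_eq [definable_intros]:
  "is_term A s \<Longrightarrow> is_term A t \<Longrightarrow> definable L A (\<lambda>e. s e = t e)"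
  using definable_subst2[of L A "(=)"] definable_sat[of "0 \<^bold>= 1" L A] by simp

lemma definable_False: "definable L A (\<lambda>e. False)"
  using definable_sat[of Bot] by simp

lemma definable_imp [definable_intros]:
  assumes "definable L A P" "definable L A P'"
  shows "definable L A (\<lambda>e. P e \<longrightarrow> P' e)"
proof -
  obtain p f where p_defines: "syms p \<subseteq> L" "range f \<subseteq> UNIV <+> A"
    "\<And>e. P e \<longleftrightarrow> sat (case_sum e id \<circ> f) p"
    using assms(1) unfolding definable_def by blast
  obtain p' f' where p'_defines: "syms p' \<subseteq> L" "range f' \<subseteq> UNIV <+> A"
    "\<And>e. P' e \<longleftrightarrow> sat (case_sum e id \<circ> f') p'"
    using assms(2) unfolding definable_def by blast
  let ?p = "rename (\<lambda>v. 2 * v) p \<^bold>\<longrightarrow> rename (\<lambda>v. 2 * v + 1) p'"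
  let ?f = "\<lambda>v. if even v then f (v div 2) else f' (v div 2)"
  have "range ?f \<subseteq> UNIV <+> A" using p_defines(2) p'_defines(2) by (simp add: image_subset_iff)
  moreover have "sat (case_sum e id \<circ> ?f) ?p \<longleftrightarrow> (P e \<longrightarrow> P' e)" for e
    by (simp add: sat_rename p_defines(3) p'_defines(3) comp_def)
  ultimately show ?thesis
    unfolding definable_def
    using p_defines(1) p'_defines(1) by (intro exI[of _ ?p] exI[of _ ?f]) simp
qed

lemma definable_not [definable_intros]: "definable L A P \<Longrightarrow> definable L A (\<lambda>e. \<not> P e)"
  using definable_imp[OF _ definable_False, of L A P] by simp

lemma definable_conj [definable_intros]:
  "definable L A P \<Longrightarrow> definable L A P' \<Longrightarrow> definable L A (\<lambda>e. P e \<and> P' e)"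
  using definable_not[OF definable_imp[OF _ definable_not, of L A P P']] by simp

lemma definable_disj [definable_intros]:
  "definable L A P \<Longrightarrow> definable L A P' \<Longrightarrow> definable L A (\<lambda>e. P e \<or> P' e)"
  using definable_imp[OF definable_not, of L A P P'] by (simp add: disj_imp)

lemma definable_iff [definable_intros]:
  "definable L A P \<Longrightarrow> definable L A P' \<Longrightarrow> definable L A (\<lambda>e. P e \<longleftrightarrow> P' e)"
  unfolding iff_conv_conj_imp by (intro definable_intros)

lemma definable_all [definable_intros]:
  assumes "definable L A (\<lambda>e. P (e 0) (\<lambda>v. e (Suc v)))"
  shows "definable L A (\<lambda>e. \<forall>x. P x e)"
proof -
  obtain p f where p_defines: "syms p \<subseteq> L" "range f \<subseteq> UNIV <+> A"
    "\<And>e. P (e 0) (\<lambda>v. e (Suc v)) \<longleftrightarrow> sat (case_sum e id \<circ> f) p"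
    using assms unfolding definable_def by blast
  let ?p = "rename (\<lambda>v. if f v = Inl 0 then 0 else Suc v) p"
  let ?f = "\<lambda>v. case_sum (\<lambda>u. Inl (u - 1)) Inr (f v)"
  have "range ?f \<subseteq> UNIV <+> A"
    using p_defines(2) by (fastforce simp: image_subset_iff split: sum.split)
  moreover have "sat (case_sum e id \<circ> ?f) (All ?p) \<longleftrightarrow> (\<forall>x. P x e)" for e
  proof -
    have env_eq: "(\<lambda>v. (x \<cdot> (case_sum e id \<circ> ?f)) (if f v = Inl 0 then 0 else Suc v)) =
      case_sum (x \<cdot> e) id \<circ> f" for x
      by (auto simp: fun_eq_iff scons_def split: sum.split nat.split)
    show ?thesis using p_defines(3)[of "_ \<cdot> e"] by (simp add: sat_rename env_eq)
  qed
  ultimately show ?thesis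
    unfolding definable_def using p_defines(1) by (intro exI[of _ "All ?p"] exI[of _ ?f]) simp
qed

lemma definable_ex [definable_intros]:
  assumes "definable L A (\<lambda>e. P (e 0) (\<lambda>v. e (Suc v)))"
  shows "definable L A (\<lambda>e. \<exists>x. P x e)"
proof -
  have "definable L A (\<lambda>e. \<not> (\<forall>x. \<not> P x e))" by (intro definable_intros assms)
  then show ?thesis by simp
qed

lemma definable_all_list [definable_intros]:
  assumes "definable L A (\<lambda>e. P (map e [0..<n]) (\<lambda>v. e (n + v)))"
  shows "definable L A (\<lambda>e. \<forall>xs. length xs = n \<longrightarrow> P xs e)"
  using assms
proof (induction n arbitrary: P)
  case (Suc n)
  have "map e [0..<Suc n] = e 0 # map (\<lambda>v. e (Suc v)) [0..<n]" for e :: "nat \<Rightarrow> 'a"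
    by (simp add: upt_conv_Cons map_Suc_upt[symmetric] comp_def del: upt_Suc)
  then have "definable L A (\<lambda>e. P (e 0 # map (\<lambda>v. e (Suc v)) [0..<n]) (\<lambda>v. e (Suc (n + v))))"
    using Suc.prems by simp
  then have "definable L A (\<lambda>e. \<forall>x. P (x # map e [0..<n]) (\<lambda>v. e (n + v)))"
    by (rule definable_all)
  then have "definable L A (\<lambda>e. \<forall>xs. length xs = n \<longrightarrow> (\<forall>x. P (x # xs) e))"
    by (rule Suc.IH)
  moreover have "(\<forall>xs. length xs = Suc n \<longrightarrow> P xs e) \<longleftrightarrow>
    (\<forall>xs. length xs = n \<longrightarrow> (\<forall>x. P (x # xs) e))" for e
    by (auto simp: length_Suc_conv)
  ultimately show ?case by simp
qed simp

lemma definable_ex_list [definable_intros]: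
  assumes "definable L A (\<lambda>e. P (map e [0..<n]) (\<lambda>v. e (n + v)))"
  shows "definable L A (\<lambda>e. \<exists>xs. length xs = n \<and> P xs e)"
proof -
  have "definable L A (\<lambda>e. \<not> (\<forall>xs. length xs = n \<longrightarrow> \<not> P xs e))"
    by (intro definable_intros assms)
  then show ?thesis by simp
qed

lemma definable_ball_list [definable_intros]:
  assumes "\<And>v. v \<in> set vs \<Longrightarrow> definable L A (\<lambda>e. P (e (f v)) e)"
  shows "definable L A (\<lambda>e. \<forall>x \<in> set (map (\<lambda>v. e (f v)) vs). P x e)"
  using assms
proof (induction vs)
  case Nil
  then show ?case using definable_not[OF definable_False] by simp
next
  case (Cons v vs)
  then show ?case by (simp add: definable_conj)
qed

lemma definable_holds:
  assumes "\<And>e. p \<in> formulas L (length (ts e))" "is_term_list A ts"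
  shows "definable L A (\<lambda>e. holds p (ts e))"
proof -
  obtain n where length_ts: "\<And>e. length (ts e) = n"
    using assms(2) unfolding is_term_list_def by auto
  let ?t = "\<lambda>v e. if v < n then ts e ! v else e 0"
  have "is_term A (?t v)" for v
    using is_term_nth[OF assms(2)] is_term_variable length_ts by (cases "v < n") simp_all
  moreover have "definable L A (\<lambda>e. sat e p)"
    using assms(1) by (intro definable_sat) (auto simp: formulas_def)
  ultimately have "definable L A (\<lambda>e. sat (\<lambda>v. ?t v e) p)"
    by (rule definable_subst[rotated])
  moreover have "holds p (ts e) \<longleftrightarrow> sat (\<lambda>v. ?t v e) p" for e
    using assms(1) by (rule holds_iff_sat) (simp add: length_ts)
  ultimately show ?thesis by simp
qed

lemma formula_of_definable:
  assumes "definable L A (\<lambda>e. P (map e [0..<n]))" "0 < n"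
  shows "\<exists>p zs. p \<in> formulas L (n + length zs) \<and> set zs \<subseteq> A \<and>
    (\<forall>xs. length xs = n \<longrightarrow> (P xs \<longleftrightarrow> holds p (xs @ zs)))"
proof -
  obtain p f where syms_p: "syms p \<subseteq> L" and range_f: "range f \<subseteq> UNIV <+> A"
    and P_iff: "\<And>e. P (map e [0..<n]) \<longleftrightarrow> sat (case_sum e id \<circ> f) p"
    using assms(1) unfolding definable_def by blast
  have "finite (Inr -` f ` fv p)"
    by (intro finite_vimageI finite_imageI finite_fv) simp
  from finite_list[OF this] obtain zs where set_zs: "set zs = Inr -` f ` fv p" by blast
  have "\<forall>c \<in> set zs. \<exists>m < length zs. zs ! m = c" by (simp add: in_set_conv_nth)
  then obtain index where nth_index: "\<And>c. c \<in> set zs \<Longrightarrow> index c < length zs \<and> zs ! index c = c"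
    by metis
  let ?g = "\<lambda>v. case f v of Inl u \<Rightarrow> if u < n then u else 0 | Inr c \<Rightarrow> n + index c"
  have parameter: "index c < length zs" "zs ! index c = c" if "v \<in> fv p" "f v = Inr c" for v c
    using nth_index[of c] image_eqI[of "Inr c" f v "fv p"] that set_zs by auto
  have "?g v < n + length zs" if "v \<in> fv p" for v
    using parameter(1)[OF that] assms(2) by (auto split: sum.split)
  then have "rename ?g p \<in> formulas L (n + length zs)"
    using syms_p by (auto simp: formulas_def fv_rename)
  moreover have "set zs \<subseteq> A" using set_zs range_f by auto
  moreover have "P xs \<longleftrightarrow> holds (rename ?g p) (xs @ zs)" if "length xs = n" for xs
  proof -
    let ?e = "\<lambda>v. xs ! (if v < n then v else 0)"
    have "map ?e [0..<n] = xs" using that by (intro nth_equalityI) simp_all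
    then have "P xs \<longleftrightarrow> sat (case_sum ?e id \<circ> f) p" using P_iff[of ?e] by simp
    also have "\<dots> \<longleftrightarrow> sat (\<lambda>v. (xs @ zs) ! ?g v) p"
      using that assms(2) parameter by (intro sat_cong) (auto simp: nth_append split: sum.split)
    finally show ?thesis by (simp add: holds_def sat_rename)
  qed
  ultimately show ?thesis by blast
qed

end

section \<open>Set-theoretic notions in a structure\<close>

context membership_structure
begin

abbreviation mem_eq :: "'a \<Rightarrow> 'a \<Rightarrow> bool"  (infix "\<epsilon>\<^sub>=" 50) where
  "x \<epsilon>\<^sub>= y \<equiv> x \<epsilon> y \<or> x = y"

definition small :: "('a \<Rightarrow> bool) \<Rightarrow> bool" where
  "small P \<longleftrightarrow> (\<exists>w. \<forall>z. z \<epsilon> w \<longleftrightarrow> P z)"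

definition sub :: "'a \<Rightarrow> 'a \<Rightarrow> bool" where
  "sub x y \<longleftrightarrow> (\<forall>z. z \<epsilon> x \<longrightarrow> z \<epsilon> y)"

definition opair :: "'a \<Rightarrow> 'a \<Rightarrow> 'a \<Rightarrow> bool" where
  "opair p a b \<longleftrightarrow> (\<exists>s d. (\<forall>z. z \<epsilon> s \<longleftrightarrow> z = a) \<and> (\<forall>z. z \<epsilon> d \<longleftrightarrow> z = a \<or> z = b) \<and>
    (\<forall>z. z \<epsilon> p \<longleftrightarrow> z = s \<or> z = d))"

definition maps :: "'a \<Rightarrow> 'a \<Rightarrow> 'a \<Rightarrow> bool" where
  "maps f a b \<longleftrightarrow> (\<exists>p. p \<epsilon> f \<and> opair p a b)"

definition ord :: "'a \<Rightarrow> bool" where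
  "ord x \<longleftrightarrow> (\<forall>y. y \<epsilon> x \<longrightarrow> sub y x) \<and> (\<forall>y z. y \<epsilon> x \<longrightarrow> z \<epsilon> x \<longrightarrow> y \<epsilon> z \<or> y = z \<or> z \<epsilon> y)"

text \<open>\<open>f\<close> is the function on \<open>a \<union> {a}\<close> given by \<open>f(b) = \<Union>{{z. Q z (f(g))} | g \<in> b}\<close>.\<close>

definition recfun :: "('a \<Rightarrow> 'a \<Rightarrow> bool) \<Rightarrow> 'a \<Rightarrow> 'a \<Rightarrow> bool" where
  "recfun Q a f \<longleftrightarrow>
    (\<forall>p. p \<epsilon> f \<longrightarrow> (\<exists>b y. opair p b y \<and> b \<epsilon>\<^sub>= a)) \<and>
    (\<forall>b. b \<epsilon>\<^sub>= a \<longrightarrow> (\<exists>y. \<forall>z. maps f b z \<longleftrightarrow> z = y)) \<and>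
    (\<forall>b y. b \<epsilon>\<^sub>= a \<and> maps f b y \<longrightarrow> (\<forall>z. z \<epsilon> y \<longleftrightarrow> (\<exists>g u. g \<epsilon> b \<and> maps f g u \<and> Q z u)))"

definition isrec :: "('a \<Rightarrow> 'a \<Rightarrow> bool) \<Rightarrow> 'a \<Rightarrow> 'a \<Rightarrow> bool" where
  "isrec Q a v \<longleftrightarrow> (\<exists>f. recfun Q a f \<and> maps f a v)"

definition inV :: "'a \<Rightarrow> 'a \<Rightarrow> bool" where
  "inV x a \<longleftrightarrow> (\<exists>v. isrec sub a v \<and> x \<epsilon> v)"

lemma sat_Sub [simp]: "sat e (Sub a b) = sub (e a) (e b)"
  by (simp add: Sub_def sub_def)

lemma sat_IsOPair [simp]: "sat e (IsOPair p a b) = opair (e p) (e a) (e b)"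
  by (simp add: IsOPair_def opair_def IsUPair_def)

lemma sat_Maps [simp]: "sat e (Maps f a b) = maps (e f) (e a) (e b)"
  by (simp add: Maps_def maps_def)

lemma sat_IsV [simp]: "sat e (IsV a v) = isrec sub (e a) (e v)"
  by (simp add: IsV_def isrec_def recfun_def)

lemma sat_InV [simp]: "sat e (InV x a) = inV (e x) (e a)"
  by (simp add: InV_def inV_def)

lemma definable_sub [definable_intros]:
  "is_term A s \<Longrightarrow> is_term A t \<Longrightarrow> definable L A (\<lambda>e. sub (s e) (t e))"
  by (rule definable_subst2) (unfold sub_def, intro definable_intros)

lemma definable_opair [definable_intros]:
  "is_term A s \<Longrightarrow> is_term A t \<Longrightarrow> is_term A u \<Longrightarrow> definable L A (\<lambda>e. opair (s e) (t e) (u e))"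
  by (rule definable_subst3) (unfold opair_def, intro definable_intros)

lemma definable_maps [definable_intros]:
  "is_term A s \<Longrightarrow> is_term A t \<Longrightarrow> is_term A u \<Longrightarrow> definable L A (\<lambda>e. maps (s e) (t e) (u e))"
  by (rule definable_subst3) (unfold maps_def, intro definable_intros)

lemma definable_ord [definable_intros]: "is_term A s \<Longrightarrow> definable L A (\<lambda>e. ord (s e))"
  by (rule definable_subst1) (unfold ord_def, intro definable_intros)

lemma definable_isrec:
  assumes "definable L A (\<lambda>e. Q (e 0) (e 1))" "is_term A s" "is_term A t"
  shows "definable L A (\<lambda>e. isrec Q (s e) (t e))"
  using assms(2,3)
  by (rule definable_subst2[rotated])
    (unfold isrec_def recfun_def, intro definable_intros definable_subst2[OF assms(1)])

lemma definable_inV [definable_intros]: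
  "is_term A s \<Longrightarrow> is_term A t \<Longrightarrow> definable L A (\<lambda>e. inV (s e) (t e))"
  by (rule definable_subst2) (unfold inV_def, intro definable_intros definable_isrec)

lemma small_mem: "small (\<lambda>z. z \<epsilon> x)"
  unfolding small_def by blast

lemma smallE: assumes "small P" obtains w where "\<forall>z. z \<epsilon> w \<longleftrightarrow> P z"
  using assms unfolding small_def by blast

end

section \<open>Set theory in a model\<close>

locale zf_model = membership_structure E R I for E (infix "\<epsilon>" 50) and R I +
  fixes K :: "sym set"
  assumes extensionality: "(\<And>z. z \<epsilon> x \<longleftrightarrow> z \<epsilon> y) \<Longrightarrow> x = y"
    and foundation: "y \<epsilon> x \<Longrightarrow> \<exists>m. m \<epsilon> x \<and> (\<forall>z. z \<epsilon> x \<longrightarrow> \<not> z \<epsilon> m)"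
    and pairing: "small (\<lambda>z. z = a \<or> z = b)"
    and union: "small (\<lambda>z. \<exists>y. y \<epsilon> x \<and> z \<epsilon> y)"
    and power: "small (\<lambda>z. sub z x)"
    and infinity: "\<exists>w. (\<exists>z. z \<epsilon> w \<and> (\<forall>u. \<not> u \<epsilon> z)) \<and>
      (\<forall>x. x \<epsilon> w \<longrightarrow> (\<exists>s. s \<epsilon> w \<and> (\<forall>z. z \<epsilon> s \<longleftrightarrow> z \<epsilon>\<^sub>= x)))"
    and separation: "definable K UNIV (\<lambda>e. P (e 0)) \<Longrightarrow> small (\<lambda>x. x \<epsilon> v \<and> P x)"
    and collection: "definable (insert ISym K) UNIV (\<lambda>e. S (e 0) (e 1)) \<Longrightarrow>
      (\<And>x. x \<epsilon> v \<Longrightarrow> \<exists>y. S x y) \<Longrightarrow> \<exists>w. \<forall>x. x \<epsilon> v \<longrightarrow> (\<exists>y. y \<epsilon> w \<and> S x y)"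
begin

lemma small_singleton: "small (\<lambda>z. z = a)"
  using pairing[of a a] by simp

lemma small_disj: assumes "small P" "small Q" shows "small (\<lambda>z. P z \<or> Q z)"
proof -
  obtain x where mem_x: "\<forall>z. z \<epsilon> x \<longleftrightarrow> P z" by (rule smallE[OF assms(1)])
  obtain y where mem_y: "\<forall>z. z \<epsilon> y \<longleftrightarrow> Q z" by (rule smallE[OF assms(2)])
  obtain d where mem_d: "\<forall>z. z \<epsilon> d \<longleftrightarrow> z = x \<or> z = y" by (rule smallE[OF pairing])
  have "(\<exists>t. t \<epsilon> d \<and> z \<epsilon> t) \<longleftrightarrow> P z \<or> Q z" for z by (auto simp: mem_x mem_y mem_d)
  then show ?thesis using union[of d] by simp
qed

lemma small_insert: "small (\<lambda>z. z \<epsilon>\<^sub>= x)"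
  by (intro small_disj small_mem small_singleton)

lemma small_Collect:
  assumes "definable K UNIV (\<lambda>e. P (e 0))" "small Q" shows "small (\<lambda>x. Q x \<and> P x)"
proof -
  obtain v where "\<forall>x. x \<epsilon> v \<longleftrightarrow> Q x" by (rule smallE[OF assms(2)])
  then show ?thesis using separation[OF assms(1), of v] by simp
qed

lemma small_UN:
  assumes "definable K UNIV (\<lambda>e. S (e 0) (e 1))" and small: "\<And>x. x \<epsilon> v \<Longrightarrow> small (\<lambda>z. S z x)"
  shows "small (\<lambda>z. \<exists>x. x \<epsilon> v \<and> S z x)"
proof -
  note [definable_intros] = definable_subst2[OF assms(1)]
  have "definable K UNIV (\<lambda>e. \<forall>z. z \<epsilon> e 1 \<longleftrightarrow> S z (e 0))" by (intro definable_intros)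
  then have "definable (insert ISym K) UNIV (\<lambda>e. \<forall>z. z \<epsilon> e 1 \<longleftrightarrow> S z (e 0))"
    by (rule definable_mono) blast
  then have "\<exists>w. \<forall>x. x \<epsilon> v \<longrightarrow> (\<exists>y. y \<epsilon> w \<and> (\<forall>z. z \<epsilon> y \<longleftrightarrow> S z x))"
    by (rule collection) (use small in \<open>simp add: small_def\<close>)
  then obtain w where w_bound: "\<And>x. x \<epsilon> v \<Longrightarrow> \<exists>y. y \<epsilon> w \<and> (\<forall>z. z \<epsilon> y \<longleftrightarrow> S z x)" by blast
  have "small (\<lambda>z. (\<exists>y. y \<epsilon> w \<and> z \<epsilon> y) \<and> (\<exists>x. x \<epsilon> v \<and> S z x))"
    by (rule small_Collect[OF _ union]) (intro definable_intros)
  moreover have "(\<exists>y. y \<epsilon> w \<and> z \<epsilon> y) \<and> (\<exists>x. x \<epsilon> v \<and> S z x) \<longleftrightarrow> (\<exists>x. x \<epsilon> v \<and> S z x)" for z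
    using w_bound by blast
  ultimately show ?thesis by simp
qed

lemma collection_partial:
  assumes "definable (insert ISym K) UNIV (\<lambda>e. S (e 0) (e 1))"
  shows "\<exists>w. \<forall>x y. x \<epsilon> v \<longrightarrow> S x y \<longrightarrow> (\<exists>y. y \<epsilon> w \<and> S x y)"
proof -
  note [definable_intros] = definable_subst2[OF assms]
  have "\<exists>w. \<forall>x. x \<epsilon> v \<longrightarrow> (\<exists>y. y \<epsilon> w \<and> ((\<exists>y. S x y) \<longrightarrow> S x y))"
    by (rule collection) (intro definable_intros, blast)
  then show ?thesis by blast
qed

subsection \<open>Pairs\<close>

lemma no_three_cycle: "\<not> (x \<epsilon> y \<and> y \<epsilon> z \<and> z \<epsilon> x)"
proof
  assume cycle: "x \<epsilon> y \<and> y \<epsilon> z \<and> z \<epsilon> x"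
  have "small (\<lambda>u. (u = x \<or> u = y) \<or> u = z)" by (intro small_disj small_singleton)
  then obtain s where "\<forall>u. u \<epsilon> s \<longleftrightarrow> u = x \<or> u = y \<or> u = z" unfolding small_def by auto
  then show False using foundation[of x s] cycle by metis
qed

lemma no_two_cycle: "\<not> (x \<epsilon> y \<and> y \<epsilon> x)"
proof
  assume cycle: "x \<epsilon> y \<and> y \<epsilon> x"
  obtain s where "\<forall>u. u \<epsilon> s \<longleftrightarrow> u = x \<or> u = y" by (rule smallE[OF pairing])
  then show False using foundation[of x s] cycle by metis
qed

lemma not_mem_self: "\<not> x \<epsilon> x"
  using no_two_cycle by blast

lemma opair_exists: "\<exists>p. opair p a b"
proof -
  obtain s where mem_s: "\<forall>z. z \<epsilon> s \<longleftrightarrow> z = a" by (rule smallE[OF small_singleton])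
  obtain d where mem_d: "\<forall>z. z \<epsilon> d \<longleftrightarrow> z = a \<or> z = b" by (rule smallE[OF pairing])
  obtain p where "\<forall>z. z \<epsilon> p \<longleftrightarrow> z = s \<or> z = d" by (rule smallE[OF pairing])
  then show ?thesis unfolding opair_def using mem_s mem_d by blast
qed

lemma opair_unique: assumes "opair p a b" "opair q a b" shows "p = q"
proof -
  obtain s d s' d' where "\<forall>z. z \<epsilon> s \<longleftrightarrow> z = a" "\<forall>z. z \<epsilon> d \<longleftrightarrow> z = a \<or> z = b" "\<forall>z. z \<epsilon> s' \<longleftrightarrow> z = a"
    "\<forall>z. z \<epsilon> d' \<longleftrightarrow> z = a \<or> z = b" and mem_p: "\<forall>z. z \<epsilon> p \<longleftrightarrow> z = s \<or> z = d"
    and mem_q: "\<forall>z. z \<epsilon> q \<longleftrightarrow> z = s' \<or> z = d'"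
    using assms unfolding opair_def by blast
  then have "s = s'" "d = d'" by (auto intro!: extensionality)
  then show "p = q" using mem_p mem_q by (auto intro!: extensionality)
qed

lemma opair_inject: assumes "opair p a b" "opair p a' b'" shows "a = a' \<and> b = b'"
proof -
  obtain s d s' d' where
    "\<forall>z. z \<epsilon> s \<longleftrightarrow> z = a" "\<forall>z. z \<epsilon> d \<longleftrightarrow> z = a \<or> z = b" "\<forall>z. z \<epsilon> p \<longleftrightarrow> z = s \<or> z = d"
    "\<forall>z. z \<epsilon> s' \<longleftrightarrow> z = a'" "\<forall>z. z \<epsilon> d' \<longleftrightarrow> z = a' \<or> z = b'" "\<forall>z. z \<epsilon> p \<longleftrightarrow> z = s' \<or> z = d'"
    using assms unfolding opair_def by blast
  then show ?thesis by metis
qed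

lemma product_superset: "\<exists>w. \<forall>a b p. a \<epsilon> x \<longrightarrow> b \<epsilon> y \<longrightarrow> opair p a b \<longrightarrow> p \<epsilon> w"
proof -
  obtain u where mem_u: "\<forall>z. z \<epsilon> u \<longleftrightarrow> z \<epsilon> x \<or> z \<epsilon> y"
    by (rule smallE[OF small_disj[OF small_mem small_mem]])
  obtain v where mem_v: "\<forall>z. z \<epsilon> v \<longleftrightarrow> sub z u" by (rule smallE[OF power])
  obtain w where mem_w: "\<forall>z. z \<epsilon> w \<longleftrightarrow> sub z v" by (rule smallE[OF power])
  have "p \<epsilon> w" if "a \<epsilon> x" "b \<epsilon> y" and opair_p: "opair p a b" for a b p
  proof -
    obtain s d where "\<forall>z. z \<epsilon> s \<longleftrightarrow> z = a" "\<forall>z. z \<epsilon> d \<longleftrightarrow> z = a \<or> z = b" "\<forall>z. z \<epsilon> p \<longleftrightarrow> z = s \<or> z = d"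
      using opair_p unfolding opair_def by blast
    then show ?thesis using \<open>a \<epsilon> x\<close> \<open>b \<epsilon> y\<close> mem_u mem_v mem_w unfolding sub_def by auto
  qed
  then show ?thesis by blast
qed

lemma maps_graph:
  assumes "\<And>p. p \<epsilon> f \<longleftrightarrow> (\<exists>b y. G b y \<and> opair p b y)"
  shows "maps f b y \<longleftrightarrow> G b y"
  unfolding maps_def assms using opair_inject opair_exists by blast

subsection \<open>Ordinals\<close>

lemma sat_Ord [simp]: "sat e (Ord v) = ord (e v)"
proof
  let ?x = "e v"
  have Ord_iff: "sat e (Ord v) \<longleftrightarrow> (\<forall>y. y \<epsilon> ?x \<longrightarrow> sub y ?x) \<and> (\<forall>y. y \<epsilon> ?x \<longrightarrow> \<not> y \<epsilon> y) \<and>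
    (\<forall>a. a \<epsilon> ?x \<longrightarrow> (\<forall>b. b \<epsilon> ?x \<longrightarrow> (\<forall>c. c \<epsilon> ?x \<longrightarrow> a \<epsilon> b \<and> b \<epsilon> c \<longrightarrow> a \<epsilon> c))) \<and>
    (\<forall>y. y \<epsilon> ?x \<longrightarrow> (\<forall>z. z \<epsilon> ?x \<longrightarrow> y \<epsilon> z \<or> y = z \<or> z \<epsilon> y)) \<and>
    (\<forall>s. sub s ?x \<and> (\<exists>y. y \<epsilon> s) \<longrightarrow> (\<exists>m. m \<epsilon> s \<and> (\<forall>z. z \<epsilon> s \<longrightarrow> m \<epsilon>\<^sub>= z)))"
    by (simp add: Ord_def Nonempty_def)
  show "sat e (Ord v) \<Longrightarrow> ord ?x" unfolding Ord_iff ord_def by blast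
  assume ord: "ord ?x"
  have transitive: "a \<epsilon> c" if "a \<epsilon> ?x" "b \<epsilon> ?x" "c \<epsilon> ?x" "a \<epsilon> b" "b \<epsilon> c" for a b c
  proof -
    have "a \<epsilon> c \<or> a = c \<or> c \<epsilon> a" using ord that(1,3) unfolding ord_def by blast
    then show ?thesis using that(4,5) no_two_cycle[of a b] no_three_cycle[of a b c] by blast
  qed
  have least: "\<exists>m. m \<epsilon> s \<and> (\<forall>z. z \<epsilon> s \<longrightarrow> m \<epsilon>\<^sub>= z)" if "sub s ?x" "y \<epsilon> s" for s y
  proof -
    obtain m where m_minimal: "m \<epsilon> s" "\<forall>z. z \<epsilon> s \<longrightarrow> \<not> z \<epsilon> m" using foundation[OF \<open>y \<epsilon> s\<close>] by blast
    have "m \<epsilon> z \<or> m = z \<or> z \<epsilon> m" if "z \<epsilon> s" for z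
      using ord \<open>sub s ?x\<close> that m_minimal(1) unfolding ord_def sub_def by blast
    then show ?thesis using m_minimal by blast
  qed
  show "sat e (Ord v)"
    unfolding Ord_iff
  proof (intro conjI)
    show "\<forall>s. sub s ?x \<and> (\<exists>y. y \<epsilon> s) \<longrightarrow> (\<exists>m. m \<epsilon> s \<and> (\<forall>z. z \<epsilon> s \<longrightarrow> m \<epsilon>\<^sub>= z))"
      using least by blast
  qed (use ord not_mem_self transitive in \<open>unfold ord_def, blast+\<close>)
qed

lemma ord_trans: "ord c \<Longrightarrow> a \<epsilon> b \<Longrightarrow> b \<epsilon> c \<Longrightarrow> a \<epsilon> c"
  unfolding ord_def sub_def by blast

lemma ord_mem: assumes "ord a" "b \<epsilon> a" shows "ord b"
  unfolding ord_def sub_def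
proof (intro conjI allI impI)
  fix y z assume "y \<epsilon> b" "z \<epsilon> y"
  then have "y \<epsilon> a" "z \<epsilon> a" using assms ord_trans by blast+
  then show "z \<epsilon> b" using assms \<open>y \<epsilon> b\<close> \<open>z \<epsilon> y\<close> no_two_cycle[of z y] no_three_cycle[of b z y]
    unfolding ord_def by blast
next
  fix y z assume "y \<epsilon> b" "z \<epsilon> b"
  then have "y \<epsilon> a" "z \<epsilon> a" using assms ord_trans by blast+
  then show "y \<epsilon> z \<or> y = z \<or> z \<epsilon> y" using assms unfolding ord_def by blast
qed

lemma ord_induct:
  assumes definable_P: "definable K UNIV (\<lambda>e. P (e 0))" and "ord a"
    and step: "\<And>a. ord a \<Longrightarrow> (\<And>b. b \<epsilon> a \<Longrightarrow> P b) \<Longrightarrow> P a"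
  shows "P a"
proof (rule ccontr)
  assume "\<not> P a"
  have "small (\<lambda>x. x \<epsilon>\<^sub>= a \<and> \<not> P x)"
    by (rule small_Collect[OF _ small_insert]) (intro definable_intros definable_P)
  then obtain w where mem_w: "\<forall>x. x \<epsilon> w \<longleftrightarrow> x \<epsilon>\<^sub>= a \<and> \<not> P x" by (rule smallE)
  then have "a \<epsilon> w" using \<open>\<not> P a\<close> by blast
  then obtain m where m_minimal: "m \<epsilon> w" "\<forall>z. z \<epsilon> w \<longrightarrow> \<not> z \<epsilon> m" using foundation by blast
  then have "ord m" using mem_w ord_mem[OF \<open>ord a\<close>, of m] \<open>ord a\<close> by blast
  moreover have "P b" if "b \<epsilon> m" for b
    using m_minimal that mem_w ord_trans[OF \<open>ord a\<close> that] by blast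
  ultimately have "P m" by (rule step)
  then show False using m_minimal(1) mem_w by blast
qed

lemma proper_subordinal_mem:
  assumes "ord a" "ord c" "sub c a" "c \<noteq> a" shows "c \<epsilon> a"
proof -
  have "small (\<lambda>z. z \<epsilon> a \<and> \<not> z \<epsilon> c)" by (rule separation) (intro definable_intros)
  then obtain d where mem_d: "\<forall>z. z \<epsilon> d \<longleftrightarrow> z \<epsilon> a \<and> \<not> z \<epsilon> c" by (rule smallE)
  have "\<exists>z. z \<epsilon> d" using assms(3,4) mem_d extensionality unfolding sub_def by blast
  then obtain m where m_minimal: "m \<epsilon> d" "\<forall>z. z \<epsilon> d \<longrightarrow> \<not> z \<epsilon> m" using foundation by blast
  have "m = c"
  proof (rule extensionality)
    fix z
    show "z \<epsilon> m \<longleftrightarrow> z \<epsilon> c"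
    proof
      assume "z \<epsilon> m"
      then have "z \<epsilon> a" using m_minimal(1) mem_d ord_trans[OF assms(1)] by blast
      then show "z \<epsilon> c" using \<open>z \<epsilon> m\<close> m_minimal(2) mem_d by blast
    next
      assume "z \<epsilon> c"
      then have "z \<epsilon> m \<or> z = m \<or> m \<epsilon> z"
        using assms(1,3) m_minimal(1) mem_d unfolding ord_def sub_def by blast
      then show "z \<epsilon> m" using \<open>z \<epsilon> c\<close> m_minimal(1) mem_d ord_trans[OF assms(2)] by blast
    qed
  qed
  then show ?thesis using m_minimal(1) mem_d by blast
qed

lemma ord_linear: assumes "ord a" "ord b" shows "a \<epsilon> b \<or> a = b \<or> b \<epsilon> a"
proof -
  have "small (\<lambda>z. z \<epsilon> a \<and> z \<epsilon> b)" by (rule separation) (intro definable_intros)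
  then obtain c where mem_c: "\<forall>z. z \<epsilon> c \<longleftrightarrow> z \<epsilon> a \<and> z \<epsilon> b" by (rule smallE)
  have "ord c"
    unfolding ord_def sub_def mem_c[rule_format] using assms ord_trans unfolding ord_def by blast
  have "sub c a" "sub c b" using mem_c unfolding sub_def by blast+
  then have "c \<epsilon> a \<or> c = a" "c \<epsilon> b \<or> c = b"
    using proper_subordinal_mem[OF _ \<open>ord c\<close>] assms by blast+
  then show ?thesis using mem_c not_mem_self[of c] by blast
qed

lemma ord_of_transitive:
  assumes "\<And>y. y \<epsilon> u \<Longrightarrow> ord y" "\<And>y. y \<epsilon> u \<Longrightarrow> sub y u" shows "ord u"
  unfolding ord_def using assms ord_linear by blast

lemma ord_succ: assumes "ord a" shows "\<exists>s. ord s \<and> (\<forall>z. z \<epsilon> s \<longleftrightarrow> z \<epsilon>\<^sub>= a)"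
proof -
  obtain s where mem_s: "\<forall>z. z \<epsilon> s \<longleftrightarrow> z \<epsilon>\<^sub>= a" by (rule smallE[OF small_insert])
  have "ord s" using assms unfolding ord_def sub_def mem_s[rule_format] by blast
  then show ?thesis using mem_s by blast
qed

lemma ord_bound: "\<exists>b. ord b \<and> (\<forall>a. a \<epsilon> u \<longrightarrow> ord a \<longrightarrow> a \<epsilon> b)"
proof -
  have "small (\<lambda>x. x \<epsilon> u \<and> ord x)" by (rule separation) (intro definable_intros)
  then obtain w where mem_w: "\<forall>x. x \<epsilon> w \<longleftrightarrow> x \<epsilon> u \<and> ord x" by (rule smallE)
  obtain c where mem_c: "\<forall>z. z \<epsilon> c \<longleftrightarrow> (\<exists>y. y \<epsilon> w \<and> z \<epsilon> y)" by (rule smallE[OF union])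
  have "ord c"
  proof (rule ord_of_transitive)
    show "ord y" if "y \<epsilon> c" for y using that mem_w mem_c ord_mem by blast
    show "sub y c" if y_mem_c: "y \<epsilon> c" for y
    proof -
      obtain x where x_above_y: "x \<epsilon> w" "y \<epsilon> x" using y_mem_c mem_c by blast
      then have "sub y x" using mem_w unfolding ord_def by blast
      then show ?thesis using x_above_y(1) mem_c unfolding sub_def by blast
    qed
  qed
  then obtain b where b_succ: "ord b" "\<forall>z. z \<epsilon> b \<longleftrightarrow> z \<epsilon>\<^sub>= c" using ord_succ by blast
  have "a \<epsilon> b" if "a \<epsilon> u" "ord a" for a
    using ord_linear[OF that(2) \<open>ord c\<close>] that mem_w mem_c b_succ not_mem_self by blast
  then show ?thesis using b_succ by blast
qed

lemma limit_ordinal: "\<exists>l. ord l \<and> (\<exists>z. z \<epsilon> l) \<and> (\<forall>a. a \<epsilon> l \<longrightarrow> (\<exists>b. b \<epsilon> l \<and> a \<epsilon> b))"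
proof -
  obtain w z where z_empty: "z \<epsilon> w" "\<forall>u. \<not> u \<epsilon> z"
    and w_inductive: "\<forall>x. x \<epsilon> w \<longrightarrow> (\<exists>s. s \<epsilon> w \<and> (\<forall>z. z \<epsilon> s \<longleftrightarrow> z \<epsilon>\<^sub>= x))"
    using infinity by blast
  have "small (\<lambda>x. x \<epsilon> w \<and> (ord x \<and> sub x w))" by (rule separation) (intro definable_intros)
  then obtain l where mem_l: "\<forall>x. x \<epsilon> l \<longleftrightarrow> x \<epsilon> w \<and> ord x \<and> sub x w" by (rule smallE)
  have sub_l: "sub y l" if "y \<epsilon> l" for y
    unfolding sub_def
  proof (intro allI impI)
    fix z assume "z \<epsilon> y"
    have "ord y" "sub y w" using that mem_l by blast+
    then have "ord z" "z \<epsilon> w" "sub z w"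
      using \<open>z \<epsilon> y\<close> ord_mem[of y z] ord_trans[of y _ z] unfolding sub_def by blast+
    then show "z \<epsilon> l" using mem_l by blast
  qed
  have "ord l"
    by (rule ord_of_transitive) (use mem_l sub_l in auto)
  moreover have "z \<epsilon> l" using z_empty mem_l unfolding ord_def sub_def by blast
  moreover have "\<exists>b. b \<epsilon> l \<and> a \<epsilon> b" if "a \<epsilon> l" for a
  proof -
    have a_in_w: "a \<epsilon> w" "ord a" "sub a w" using that mem_l by blast+
    obtain b where b_succ: "b \<epsilon> w" "\<forall>z. z \<epsilon> b \<longleftrightarrow> z \<epsilon>\<^sub>= a" using w_inductive a_in_w(1) by blast
    obtain s where s_succ: "ord s" "\<forall>z. z \<epsilon> s \<longleftrightarrow> z \<epsilon>\<^sub>= a" using ord_succ[OF a_in_w(2)] by blast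
    have "b = s" by (rule extensionality) (simp add: b_succ s_succ)
    then have "b \<epsilon> l" using b_succ s_succ(1) mem_l a_in_w(1,3) unfolding sub_def by auto
    then show ?thesis using b_succ(2) by blast
  qed
  ultimately show ?thesis by blast
qed

end

subsection \<open>Recursion on ordinals\<close>

locale recursion = zf_model +
  fixes Q :: "'a \<Rightarrow> 'a \<Rightarrow> bool"
  assumes definable_Q: "definable K UNIV (\<lambda>e. Q (e 0) (e 1))"
    and set_like: "small (\<lambda>z. Q z u)"
begin

lemmas recursion_definable_intros =
  definable_intros definable_subst2[OF definable_Q] definable_isrec[OF definable_Q]

lemma recfun_ex1: "recfun Q a f \<Longrightarrow> b \<epsilon>\<^sub>= a \<Longrightarrow> \<exists>y. \<forall>z. maps f b z \<longleftrightarrow> z = y"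
  unfolding recfun_def by blast

lemma recfun_mem:
  "recfun Q a f \<Longrightarrow> b \<epsilon>\<^sub>= a \<Longrightarrow> maps f b y \<Longrightarrow> z \<epsilon> y \<longleftrightarrow> (\<exists>g u. g \<epsilon> b \<and> maps f g u \<and> Q z u)"
  unfolding recfun_def by blast

lemma recfun_of_graph:
  assumes graph_f: "\<And>p. p \<epsilon> f \<longleftrightarrow> (\<exists>b y. G b y \<and> opair p b y)" and "\<And>b y. G b y \<Longrightarrow> b \<epsilon>\<^sub>= a"
    and "\<And>b. b \<epsilon>\<^sub>= a \<Longrightarrow> \<exists>y. \<forall>z. G b z \<longleftrightarrow> z = y"
    and "\<And>b y z. G b y \<Longrightarrow> z \<epsilon> y \<longleftrightarrow> (\<exists>g u. g \<epsilon> b \<and> G g u \<and> Q z u)"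
  shows "recfun Q a f"
  unfolding recfun_def maps_graph[OF graph_f] unfolding graph_f using assms(2-4) by blast

lemma recfun_agree:
  assumes "ord a" "ord a'" and recfun_f: "recfun Q a f" "recfun Q a' f'"
    and "b \<epsilon>\<^sub>= a" "b \<epsilon>\<^sub>= a'" and "maps f b y" "maps f' b y'"
  shows "y = y'"
proof -
  define agree_at where "agree_at b \<longleftrightarrow> (b \<epsilon>\<^sub>= a \<and> b \<epsilon>\<^sub>= a' \<longrightarrow>
    (\<forall>y y'. maps f b y \<longrightarrow> maps f' b y' \<longrightarrow> y = y'))" for b
  have "ord b" using assms(1,5) ord_mem by blast
  have "agree_at b"
  proof (rule ord_induct[OF _ \<open>ord b\<close>])
    show "definable K UNIV (\<lambda>e. agree_at (e 0))"
      unfolding agree_at_def by (intro definable_intros)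
    show "agree_at b" if IH: "\<And>g. g \<epsilon> b \<Longrightarrow> agree_at g" for b
      unfolding agree_at_def
    proof (intro impI allI extensionality, elim conjE)
      fix y y' z assume b_below: "b \<epsilon>\<^sub>= a" "b \<epsilon>\<^sub>= a'" and maps_b: "maps f b y" "maps f' b y'"
      have "maps f g u \<longleftrightarrow> maps f' g u" if "g \<epsilon> b" for g u
      proof -
        have g_below: "g \<epsilon>\<^sub>= a" "g \<epsilon>\<^sub>= a'"
          using that b_below ord_trans[OF \<open>ord a\<close> that] ord_trans[OF \<open>ord a'\<close> that] by blast+
        then show ?thesis
          using recfun_ex1[OF recfun_f(1) g_below(1)] recfun_ex1[OF recfun_f(2) g_below(2)]
            IH[OF that]
          unfolding agree_at_def by metis
      qed
      then show "z \<epsilon> y \<longleftrightarrow> z \<epsilon> y'"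
        using recfun_mem[OF recfun_f(1) b_below(1) maps_b(1)]
          recfun_mem[OF recfun_f(2) b_below(2) maps_b(2)]
        by blast
    qed
  qed
  then show ?thesis unfolding agree_at_def using assms(5-8) by blast
qed

lemma isrec_unique: "ord a \<Longrightarrow> isrec Q a v \<Longrightarrow> isrec Q a v' \<Longrightarrow> v = v'"
  unfolding isrec_def using recfun_agree[of a a _ _ a v v'] by blast

lemma recfun_restrict:
  assumes "ord a" and recfun_f: "recfun Q a f" and "c \<epsilon> a"
  shows "\<exists>h. recfun Q c h \<and> (\<forall>b y. b \<epsilon>\<^sub>= c \<longrightarrow> (maps h b y \<longleftrightarrow> maps f b y))"
proof -
  let ?G = "\<lambda>b y. b \<epsilon>\<^sub>= c \<and> maps f b y"
  have "small (\<lambda>p. p \<epsilon> f \<and> (\<exists>b y. ?G b y \<and> opair p b y))"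
    by (rule separation) (intro definable_intros)
  moreover have "p \<epsilon> f \<and> (\<exists>b y. ?G b y \<and> opair p b y) \<longleftrightarrow> (\<exists>b y. ?G b y \<and> opair p b y)" for p
    using opair_unique unfolding maps_def by blast
  ultimately have "small (\<lambda>p. \<exists>b y. ?G b y \<and> opair p b y)" by simp
  then obtain h where graph_h: "\<forall>p. p \<epsilon> h \<longleftrightarrow> (\<exists>b y. ?G b y \<and> opair p b y)" by (rule smallE)
  have below: "b \<epsilon>\<^sub>= a" if "b \<epsilon>\<^sub>= c" for b
    using that assms(3) ord_trans[OF assms(1) _ assms(3)] by blast
  have "recfun Q c h"
  proof (rule recfun_of_graph[OF graph_h[rule_format]])
    show "\<exists>y. \<forall>z. ?G b z \<longleftrightarrow> z = y" if "b \<epsilon>\<^sub>= c" for b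
      using that recfun_ex1[OF recfun_f below[OF that]] by blast
    show "z \<epsilon> y \<longleftrightarrow> (\<exists>g u. g \<epsilon> b \<and> ?G g u \<and> Q z u)" if "?G b y" for b y z
      using that recfun_mem[OF recfun_f below] ord_trans[OF ord_mem[OF assms(1,3)]] by blast
  qed blast
  then show ?thesis using maps_graph[OF graph_h[rule_format]] by blast
qed

lemma maps_iff_isrec:
  assumes "ord a" "recfun Q a f" "c \<epsilon> a"
  shows "maps f c u \<longleftrightarrow> isrec Q c u"
proof -
  obtain h where "recfun Q c h" "\<And>y. maps h c y \<longleftrightarrow> maps f c y"
    using recfun_restrict[OF assms] by blast
  then have "isrec Q c v" if "maps f c v" for v
    using that unfolding isrec_def by blast
  then show ?thesis
    using recfun_ex1[OF assms(2)] assms(3) isrec_unique[OF ord_mem[OF assms(1,3)]] by metis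
qed

lemma isrec_mem:
  assumes "ord a" "isrec Q a v"
  shows "z \<epsilon> v \<longleftrightarrow> (\<exists>g u. g \<epsilon> a \<and> isrec Q g u \<and> Q z u)"
proof -
  obtain f where recfun_f: "recfun Q a f" "maps f a v" using assms(2) unfolding isrec_def by blast
  then show ?thesis
    using recfun_mem[OF recfun_f(1) _ recfun_f(2), of z] maps_iff_isrec[OF assms(1) recfun_f(1)]
    by blast
qed

context
  fixes a assumes ord_a: "ord a" and isrec_below: "\<And>b. b \<epsilon> a \<Longrightarrow> \<exists>v. isrec Q b v"
begin

lemma isrec_below_ex1: "b \<epsilon> a \<Longrightarrow> \<exists>v. \<forall>u. isrec Q b u \<longleftrightarrow> u = v"
  using isrec_below isrec_unique[OF ord_mem[OF ord_a]] by blast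

lemma small_value: "small (\<lambda>z. \<exists>g u. g \<epsilon> a \<and> isrec Q g u \<and> Q z u)"
proof -
  have "small (\<lambda>z. \<exists>g. g \<epsilon> a \<and> (\<exists>u. isrec Q g u \<and> Q z u))"
  proof (rule small_UN)
    show "definable K UNIV (\<lambda>e. \<exists>u. isrec Q (e 1) u \<and> Q (e 0) u)"
      by (intro recursion_definable_intros)
    show "small (\<lambda>z. \<exists>u. isrec Q g u \<and> Q z u)" if g_mem_a: "g \<epsilon> a" for g
    proof -
      obtain v where "\<forall>u. isrec Q g u \<longleftrightarrow> u = v" using isrec_below_ex1[OF g_mem_a] by blast
      then show ?thesis using set_like[of v] by simp
    qed
  qed
  then show ?thesis by simp
qed

lemma small_graph_below: "small (\<lambda>p. \<exists>b y. (b \<epsilon> a \<and> isrec Q b y) \<and> opair p b y)"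
proof -
  have "small (\<lambda>p. \<exists>b. b \<epsilon> a \<and> (\<exists>y. isrec Q b y \<and> opair p b y))"
  proof (rule small_UN)
    show "definable K UNIV (\<lambda>e. \<exists>y. isrec Q (e 1) y \<and> opair (e 0) (e 1) y)"
      by (intro recursion_definable_intros)
    show "small (\<lambda>p. \<exists>y. isrec Q b y \<and> opair p b y)" if b_mem_a: "b \<epsilon> a" for b
    proof -
      obtain v p where isrec_b: "\<forall>u. isrec Q b u \<longleftrightarrow> u = v" and opair_p: "opair p b v"
        using isrec_below_ex1[OF b_mem_a] opair_exists by blast
      have "opair q b v \<longleftrightarrow> q = p" for q using opair_unique[OF _ opair_p] opair_p by blast
      then show ?thesis using small_singleton[of p] by (simp add: isrec_b)
    qed
  qed
  then show ?thesis by simp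
qed

lemma isrec_step: "\<exists>v. isrec Q a v"
proof -
  obtain v where mem_v: "\<And>z. z \<epsilon> v \<longleftrightarrow> (\<exists>g u. g \<epsilon> a \<and> isrec Q g u \<and> Q z u)"
    using small_value unfolding small_def by blast
  obtain t where opair_t: "opair t a v" using opair_exists by blast
  let ?G = "\<lambda>b y. b \<epsilon> a \<and> isrec Q b y \<or> b = a \<and> y = v"
  have "small (\<lambda>p. (\<exists>b y. (b \<epsilon> a \<and> isrec Q b y) \<and> opair p b y) \<or> p = t)"
    by (intro small_disj small_graph_below small_singleton)
  moreover have "(\<exists>b y. (b \<epsilon> a \<and> isrec Q b y) \<and> opair p b y) \<or> p = t \<longleftrightarrow>
    (\<exists>b y. ?G b y \<and> opair p b y)" for p
    using opair_t opair_unique by blast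
  ultimately obtain f where graph_f: "\<And>p. p \<epsilon> f \<longleftrightarrow> (\<exists>b y. ?G b y \<and> opair p b y)"
    unfolding small_def by auto
  have "recfun Q a f"
  proof (rule recfun_of_graph[OF graph_f])
    show "\<exists>y. \<forall>z. ?G b z \<longleftrightarrow> z = y" if "b \<epsilon>\<^sub>= a" for b
      using that isrec_below_ex1[of b] not_mem_self[of a] by blast
    show "z \<epsilon> y \<longleftrightarrow> (\<exists>g u. g \<epsilon> b \<and> ?G g u \<and> Q z u)" if "?G b y" for b y z
    proof -
      have "z \<epsilon> y \<longleftrightarrow> (\<exists>g u. g \<epsilon> b \<and> isrec Q g u \<and> Q z u)"
        using that mem_v isrec_mem[OF ord_mem[OF ord_a]] by blast
      moreover have "g \<epsilon> a \<and> g \<noteq> a" if "g \<epsilon> b" for g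
        using that \<open>?G b y\<close> ord_trans[OF ord_a] not_mem_self by blast
      ultimately show ?thesis by blast
    qed
  qed blast
  moreover have "maps f a v" unfolding maps_graph[OF graph_f] by blast
  ultimately show ?thesis unfolding isrec_def by blast
qed

end

lemma isrec_exists: assumes "ord a" shows "\<exists>v. isrec Q a v"
proof (rule ord_induct[OF _ assms])
  show "definable K UNIV (\<lambda>e. \<exists>v. isrec Q (e 0) v)" by (intro recursion_definable_intros)
qed (rule isrec_step)

end

subsection \<open>The cumulative hierarchy\<close>

context zf_model
begin

lemma transitive_superset: "\<exists>t. x \<epsilon> t \<and> (\<forall>y z. y \<epsilon> t \<longrightarrow> z \<epsilon> y \<longrightarrow> z \<epsilon> t)"
proof -
  let ?Q = "\<lambda>z u. z = x \<or> (\<exists>y. y \<epsilon> u \<and> z \<epsilon> y)"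
  interpret recursion E R I K ?Q
  proof
    show "definable K UNIV (\<lambda>e. ?Q (e 0) (e 1))" by (intro definable_intros)
    show "small (\<lambda>z. ?Q z u)" for u by (intro small_disj small_singleton union)
  qed
  obtain l m where l_nonempty: "ord l" "m \<epsilon> l" and limit: "\<forall>a. a \<epsilon> l \<longrightarrow> (\<exists>b. b \<epsilon> l \<and> a \<epsilon> b)"
    using limit_ordinal by blast
  obtain t where isrec_t: "isrec ?Q l t" using isrec_exists[OF l_nonempty(1)] by blast
  note mem_t = isrec_mem[OF l_nonempty(1) isrec_t]
  have "x \<epsilon> t" using mem_t[of x] l_nonempty(2) isrec_exists[OF ord_mem[OF l_nonempty]] by blast
  moreover have "z \<epsilon> t" if y_mem_t: "y \<epsilon> t" and z_mem_y: "z \<epsilon> y" for y z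
  proof -
    obtain a u where a_stage: "a \<epsilon> l" "isrec ?Q a u" "?Q y u" using mem_t[of y] y_mem_t by blast
    obtain b where b_above: "b \<epsilon> l" "a \<epsilon> b" using limit a_stage(1) by blast
    then have "ord b" using ord_mem l_nonempty(1) by blast
    then obtain v where isrec_v: "isrec ?Q b v" using isrec_exists by blast
    have "y \<epsilon> v" using isrec_mem[OF \<open>ord b\<close> isrec_v] b_above(2) a_stage by blast
    then show ?thesis using mem_t[of z] b_above(1) isrec_v z_mem_y by blast
  qed
  ultimately show ?thesis by blast
qed

interpretation V: recursion E R I K sub
  by unfold_locales (intro definable_intros power)+

lemma small_V: assumes "ord a" shows "small (\<lambda>z. inV z a)"
proof -
  obtain v where "isrec sub a v" using V.isrec_exists[OF assms] by blast
  then have "z \<epsilon> v \<longleftrightarrow> inV z a" for z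
    unfolding inV_def using V.isrec_unique[OF assms] by blast
  then show ?thesis unfolding small_def by blast
qed

lemma inV_iff: assumes "ord a" shows "inV z a \<longleftrightarrow> (\<exists>b. b \<epsilon> a \<and> (\<forall>w. w \<epsilon> z \<longrightarrow> inV w b))"
proof -
  obtain v where isrec_v: "isrec sub a v" using V.isrec_exists[OF assms] by blast
  have "inV z a \<longleftrightarrow> z \<epsilon> v" unfolding inV_def using isrec_v V.isrec_unique[OF assms isrec_v] by blast
  moreover have "z \<epsilon> v \<longleftrightarrow> (\<exists>b u. b \<epsilon> a \<and> isrec sub b u \<and> sub z u)"
    by (rule V.isrec_mem[OF assms isrec_v])
  moreover have "(\<exists>u. isrec sub b u \<and> sub z u) \<longleftrightarrow> (\<forall>w. w \<epsilon> z \<longrightarrow> inV w b)" if "b \<epsilon> a" for b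
  proof -
    have "ord b" using ord_mem[OF assms that] .
    then obtain u where isrec_u: "isrec sub b u" using V.isrec_exists by blast
    show ?thesis
      unfolding inV_def sub_def[of z] using isrec_u V.isrec_unique[OF \<open>ord b\<close> isrec_u] by blast
  qed
  ultimately show ?thesis by blast
qed

lemma inV_mono: assumes "ord b" "a \<epsilon> b" "inV z a" shows "inV z b"
  using assms(3) ord_trans[OF assms(1) _ assms(2)]
  unfolding inV_iff[OF assms(1)] inV_iff[OF ord_mem[OF assms(1,2)]] by blast

lemma inV_bound:
  assumes "\<And>z. z \<epsilon> x \<Longrightarrow> \<exists>a. ord a \<and> inV z a"
  shows "\<exists>b. ord b \<and> (\<forall>z. z \<epsilon> x \<longrightarrow> inV z b)"
proof -
  have "\<exists>w. \<forall>z. z \<epsilon> x \<longrightarrow> (\<exists>a. a \<epsilon> w \<and> (ord a \<and> inV z a))"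
    by (rule collection[OF _ assms]) (intro definable_intros)
  then obtain w where w_bound: "\<And>z. z \<epsilon> x \<Longrightarrow> \<exists>a. a \<epsilon> w \<and> ord a \<and> inV z a" by blast
  obtain b where b_bound: "ord b" "\<forall>a. a \<epsilon> w \<longrightarrow> ord a \<longrightarrow> a \<epsilon> b" using ord_bound by blast
  then show ?thesis using w_bound inV_mono[OF b_bound(1)] by blast
qed

lemma in_some_V: "\<exists>a. ord a \<and> inV x a"
proof (rule ccontr)
  assume x_not_in_V: "\<not> (\<exists>a. ord a \<and> inV x a)"
  obtain t where t_transitive: "x \<epsilon> t" "\<forall>y z. y \<epsilon> t \<longrightarrow> z \<epsilon> y \<longrightarrow> z \<epsilon> t"
    using transitive_superset by blast
  have "small (\<lambda>y. y \<epsilon> t \<and> \<not> (\<exists>a. ord a \<and> inV y a))"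
    by (rule separation) (intro definable_intros)
  then obtain w where mem_w: "\<And>y. y \<epsilon> w \<longleftrightarrow> y \<epsilon> t \<and> \<not> (\<exists>a. ord a \<and> inV y a)"
    unfolding small_def by blast
  then have "x \<epsilon> w" using x_not_in_V t_transitive(1) by blast
  then obtain y where y_minimal: "y \<epsilon> w" "\<forall>z. z \<epsilon> w \<longrightarrow> \<not> z \<epsilon> y" using foundation by blast
  have "\<exists>a. ord a \<and> inV z a" if "z \<epsilon> y" for z
    using mem_w[of z] mem_w[of y] y_minimal that t_transitive(2) by blast
  then obtain b where b_bound: "ord b" "\<forall>z. z \<epsilon> y \<longrightarrow> inV z b" using inV_bound by blast
  obtain s where s_succ: "ord s" "\<forall>z. z \<epsilon> s \<longleftrightarrow> z \<epsilon>\<^sub>= b" using ord_succ[OF b_bound(1)] by blast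
  have "inV y s" unfolding inV_iff[OF s_succ(1)] using b_bound(2) s_succ(2) by blast
  then show False using mem_w[of y] y_minimal(1) s_succ(1) by blast
qed

lemma set_in_V: "\<exists>b. ord b \<and> (\<forall>z. z \<epsilon> x \<longrightarrow> inV z b)"
  using inV_bound in_some_V by blast

end

section \<open>Tuples in a model\<close>

context membership_structure
begin

text \<open>The last component of the nested pairs is arbitrary.\<close>

primrec coded :: "'a list \<Rightarrow> 'a \<Rightarrow> bool" where
  "coded [] c \<longleftrightarrow> True"
| "coded (x # xs) c \<longleftrightarrow> (\<exists>d. opair c x d \<and> coded xs d)"

definition incr :: "'a list \<Rightarrow> bool" where
  "incr xs \<longleftrightarrow> (\<forall>x \<in> set xs. I x) \<and> successively (\<epsilon>) xs"

lemma sat_IncrI [simp]: "sat e (IncrI vs) = incr (map e vs)"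
  by (induction vs rule: IncrI.induct) (auto simp: incr_def)

lemma definable_incr [definable_intros]:
  assumes "ISym \<in> L" shows "definable L A (\<lambda>e. incr (map (\<lambda>v. e (f v)) vs))"
proof -
  obtain k where "set (map f vs) \<subseteq> {..<k}" using finite_nat_iff_bounded by blast
  then have "IncrI (map f vs) \<in> formulas L k" by (rule formulas_IncrI[OF assms])
  then have "definable L A (\<lambda>e. sat e (IncrI (map f vs)))"
    by (intro definable_sat) (simp add: formulas_def)
  then show ?thesis by (simp add: comp_def)
qed

lemma definable_coded [definable_intros]: "definable L A (\<lambda>e. coded (map (\<lambda>v. e (f v)) vs) (e w))"
proof (induction vs arbitrary: f w)
  case Nil
  then show ?case using definable_not[OF definable_False] by simp
next
  case (Cons v vs)
  show ?case unfolding list.map coded.simps by (intro definable_intros Cons.IH)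
qed

end

context zf_model
begin

lemma coded_inject: "length xs = length ys \<Longrightarrow> coded xs c \<Longrightarrow> coded ys c \<Longrightarrow> xs = ys"
proof (induction xs ys arbitrary: c rule: list_induct2)
  case (Cons x xs y ys)
  then obtain d d' where "opair c x d" "coded xs d" "opair c y d'" "coded ys d'" by auto
  then show ?case using opair_inject Cons.IH by blast
qed simp

lemma set_of_codes:
  "\<exists>t. \<forall>xs. length xs = n \<longrightarrow> (\<forall>x \<in> set xs. x \<epsilon> v) \<longrightarrow> (\<exists>c. c \<epsilon> t \<and> coded xs c)"
proof (induction n)
  case 0
  then show ?case using infinity by auto
next
  case (Suc n)
  then obtain t where t_codes: "\<And>xs. length xs = n \<Longrightarrow> \<forall>x \<in> set xs. x \<epsilon> v \<Longrightarrow> \<exists>c. c \<epsilon> t \<and> coded xs c"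
    by blast
  obtain w where opair_mem_w: "\<And>x d c. x \<epsilon> v \<Longrightarrow> d \<epsilon> t \<Longrightarrow> opair c x d \<Longrightarrow> c \<epsilon> w"
    using product_superset by blast
  have "\<exists>c. c \<epsilon> w \<and> coded (x # xs) c"
    if xs_in_v: "length xs = n" "x \<epsilon> v" "\<forall>y \<in> set xs. y \<epsilon> v" for x xs
  proof -
    obtain d where d_codes: "d \<epsilon> t" "coded xs d" using t_codes xs_in_v(1,3) by blast
    obtain c where "opair c x d" using opair_exists by blast
    then show ?thesis using opair_mem_w xs_in_v(2) d_codes by auto
  qed
  then show ?case by (fastforce simp: length_Suc_conv)
qed

lemma collection_tuples:
  assumes "definable (insert ISym K) UNIV (\<lambda>e. S (map e [0..<n]) (e n))"
  shows "\<exists>b. \<forall>xs y. length xs = n \<longrightarrow> (\<forall>x \<in> set xs. x \<epsilon> v) \<longrightarrow> S xs y \<longrightarrow> (\<exists>y. y \<epsilon> b \<and> S xs y)"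
proof -
  obtain t where t_codes: "\<And>xs. length xs = n \<Longrightarrow> \<forall>x \<in> set xs. x \<epsilon> v \<Longrightarrow> \<exists>c. c \<epsilon> t \<and> coded xs c"
    using set_of_codes by blast
  let ?T = "\<lambda>c y. \<exists>xs. length xs = n \<and> coded xs c \<and> S xs y"
  have map_eq: "map (\<lambda>v. e (if v = n then n + 1 else v)) [0..<n] = map e [0..<n]"
    for e :: "nat \<Rightarrow> 'a" by simp
  have "definable (insert ISym K) UNIV (\<lambda>e. S (map e [0..<n]) (e (n + 1)))"
    using definable_subst[OF assms, of "\<lambda>v e. e (if v = n then n + 1 else v)", unfolded map_eq]
    by (simp add: is_term_variable)
  then have "definable (insert ISym K) UNIV (\<lambda>e. ?T (e 0) (e 1))"
    by (intro definable_intros)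
  from collection_partial[OF this, of t]
  obtain b where b_collects: "\<forall>c y. c \<epsilon> t \<longrightarrow> ?T c y \<longrightarrow> (\<exists>y. y \<epsilon> b \<and> ?T c y)" by (elim exE)
  have "\<exists>y. y \<epsilon> b \<and> S xs y" if S_xs: "length xs = n" "\<forall>x \<in> set xs. x \<epsilon> v" "S xs y" for xs y
  proof -
    obtain c where c_codes: "c \<epsilon> t" "coded xs c" using t_codes S_xs(1,2) by blast
    then obtain y' xs' where "y' \<epsilon> b" "length xs' = n" "coded xs' c" "S xs' y'"
      using b_collects S_xs(1,3) by blast
    then show ?thesis using coded_inject[OF _ _ c_codes(2)] S_xs(1) by metis
  qed
  then show ?thesis by blast
qed

lemma small_set: "small (\<lambda>z. z \<in> set xs)"
proof (induction xs)
  case Nil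
  show ?case using separation[of "\<lambda>_. False"] definable_False by simp
next
  case (Cons x xs)
  then show ?case using small_disj[OF small_singleton Cons, of x] by simp
qed

lemma ord_above_list: "\<exists>b. ord b \<and> (\<forall>a \<in> set as. ord a \<longrightarrow> a \<epsilon> b)"
proof -
  obtain u where "\<forall>z. z \<epsilon> u \<longleftrightarrow> z \<in> set as" by (rule smallE[OF small_set])
  then show ?thesis using ord_bound[of u] by (simp add: Ball_def)
qed

end

section \<open>Apartness and diagonal indiscernibility in a structure\<close>

context membership_structure
begin

definition apart :: "fm \<Rightarrow> nat \<Rightarrow> 'a \<Rightarrow> 'a \<Rightarrow> bool" where
  "apart p n i j \<longleftrightarrow> (\<forall>xs. length xs = n \<longrightarrow> (\<forall>x \<in> set xs. inV x i) \<longrightarrow>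
    (\<exists>y. holds p (xs @ [y])) \<longrightarrow> (\<exists>y. inV y j \<and> holds p (xs @ [y])))"

definition agree :: "fm \<Rightarrow> nat \<Rightarrow> 'a \<Rightarrow> 'a list \<Rightarrow> 'a list \<Rightarrow> bool" where
  "agree p n i js ks \<longleftrightarrow> (\<forall>xs. length xs = n \<longrightarrow> (\<forall>x \<in> set xs. inV x i) \<longrightarrow>
    (holds p (xs @ i # js) \<longleftrightarrow> holds p (xs @ i # ks)))"

definition trace :: "fm \<Rightarrow> nat \<Rightarrow> 'a \<Rightarrow> 'a \<Rightarrow> 'a \<Rightarrow> 'a list \<Rightarrow> bool" where
  "trace p n t i s js \<longleftrightarrow> (\<forall>c. c \<epsilon> t \<longrightarrow>
    (c \<epsilon> s \<longleftrightarrow> (\<exists>xs. length xs = n \<and> coded xs c \<and> holds p (xs @ i # js))))"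

lemma sat_apartness:
  assumes "p \<in> formulas L (n + 1)"
  shows "sat e (apartness n p) \<longleftrightarrow> (\<forall>i j. I i \<and> I j \<and> i \<epsilon> j \<longrightarrow> apart p n i j)"
  using assms unfolding apartness_def apart_def
  by (simp add: sat_app prepend_nth_ge all_set_conv_all_nth del: upt_Suc)

lemma sat_diagonal_indis:
  assumes "p \<in> formulas L (n + 1 + r)" "r \<ge> 1"
  shows "sat e (diagonal_indis n r p) \<longleftrightarrow> (\<forall>i js ks. length js = r \<longrightarrow> length ks = r \<longrightarrow>
    I i \<and> incr js \<and> incr ks \<and> i \<epsilon> js ! 0 \<and> i \<epsilon> ks ! 0 \<longrightarrow> agree p n i js ks)"
  using assms unfolding diagonal_indis_def agree_def
  by (simp add: sat_app prepend_nth_ge all_set_conv_all_nth del: upt_Suc)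

end

context zf_model
begin

lemma agree_if_same_trace:
  assumes codes: "\<And>xs. length xs = n \<Longrightarrow> \<forall>x \<in> set xs. inV x i \<Longrightarrow> \<exists>c. c \<epsilon> t \<and> coded xs c"
    and traces: "trace p n t i s js" "trace p n t i s ks"
  shows "agree p n i js ks"
  unfolding agree_def
proof (intro allI impI)
  fix xs assume xs_in_V: "length xs = n" "\<forall>x \<in> set xs. inV x i"
  then obtain c where c_codes: "c \<epsilon> t" "coded xs c" using codes by blast
  have "c \<epsilon> s \<longleftrightarrow> holds p (xs @ i # ls)" if "trace p n t i s ls" for ls
  proof -
    have "xs' = xs" if "length xs' = n" "coded xs' c" for xs'
      using coded_inject that xs_in_V(1) c_codes(2) by metis
    then show ?thesis using that c_codes xs_in_V(1) unfolding trace_def by blast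
  qed
  then show "holds p (xs @ i # js) \<longleftrightarrow> holds p (xs @ i # ks)" using traces by blast
qed

lemma trace_exists:
  assumes "p \<in> formulas K (n + 1 + length js)"
  shows "\<exists>s. sub s t \<and> trace p n t i s js"
proof -
  have "small (\<lambda>c. c \<epsilon> t \<and> (\<exists>xs. length xs = n \<and> coded xs c \<and> holds p (xs @ i # js)))"
    by (rule separation) (use assms in \<open>intro definable_intros definable_holds, simp_all\<close>)
  then show ?thesis unfolding small_def sub_def trace_def by blast
qed

end

section \<open>Models with indiscernibles\<close>

locale indiscernible_model = zf_model +
  assumes I_ord: "I i \<Longrightarrow> ord i" and I_cofinal: "ord a \<Longrightarrow> \<exists>i. I i \<and> a \<epsilon>\<^sub>= i"
    and indiscernible: "p \<in> formulas K (length xs) \<Longrightarrow> length ys = length xs \<Longrightarrow>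
      incr xs \<Longrightarrow> incr ys \<Longrightarrow> holds p xs \<longleftrightarrow> holds p ys"
begin

lemma indiscernible_definable:
  assumes "definable K {} (\<lambda>e. P (map e [0..<n]))"
    and "length xs = n" "length ys = n" "incr xs" "incr ys"
  shows "P xs \<longleftrightarrow> P ys"
proof (cases "n = 0")
  case False
  then obtain p where p_defines: "p \<in> formulas K n" "\<forall>xs. length xs = n \<longrightarrow> (P xs \<longleftrightarrow> holds p xs)"
    using formula_of_definable[OF assms(1)] by auto
  then show ?thesis using indiscernible[of p xs ys] assms(2-5) by simp
qed (use assms in simp)

lemma incr_iff_sorted: "incr xs \<longleftrightarrow> (\<forall>x \<in> set xs. I x) \<and> sorted_wrt (\<epsilon>) xs"
proof -
  have "successively (\<epsilon>) xs \<longleftrightarrow> sorted_wrt (\<epsilon>) xs" if "\<forall>x \<in> set xs. I x"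
    using that I_ord ord_trans by (intro successively_iff_sorted_wrt_strong) blast
  then show ?thesis unfolding incr_def by blast
qed

lemma incr_Cons: "incr (i # js) \<longleftrightarrow> I i \<and> incr js \<and> (\<forall>j \<in> set js. i \<epsilon> j)"
  unfolding incr_iff_sorted by auto

lemma incr_append: "incr (is @ js) \<longleftrightarrow> incr is \<and> incr js \<and> (\<forall>i \<in> set is. \<forall>j \<in> set js. i \<epsilon> j)"
  unfolding incr_iff_sorted by (auto simp: sorted_wrt_append)

lemma incr_ConsI: assumes "I i" "incr js" "i \<epsilon> js ! 0" shows "incr (i # js)"
  using assms unfolding incr_def by (cases js) auto

lemma I_above: assumes "ord a" shows "\<exists>i. I i \<and> a \<epsilon> i"
proof -
  obtain s where s_succ: "ord s" "\<forall>z. z \<epsilon> s \<longleftrightarrow> z \<epsilon>\<^sub>= a" using ord_succ[OF assms] by blast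
  obtain i where "I i" "s \<epsilon>\<^sub>= i" using I_cofinal[OF s_succ(1)] by blast
  then show ?thesis using s_succ ord_trans[OF I_ord] by blast
qed

lemma incr_above: "ord a \<Longrightarrow> \<exists>js. length js = n \<and> incr js \<and> (\<forall>j \<in> set js. a \<epsilon> j)"
proof (induction n arbitrary: a)
  case 0
  then show ?case by (simp add: incr_def)
next
  case (Suc n)
  obtain i where i_above: "I i" "a \<epsilon> i" using I_above[OF Suc.prems] by blast
  obtain js where js_above: "length js = n" "incr js" "\<forall>j \<in> set js. i \<epsilon> j"
    using Suc.IH[OF I_ord[OF i_above(1)]] by blast
  have "a \<epsilon> j" if "j \<in> set js" for j
    using ord_trans[OF I_ord i_above(2)] js_above that unfolding incr_def by blast
  then show ?case using i_above js_above by (intro exI[of _ "i # js"]) (simp add: incr_Cons)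
qed

subsection \<open>Apartness\<close>

lemma apart_some:
  assumes formula_p: "p \<in> formulas K (n + 1)" and "I i"
  shows "\<exists>j. I j \<and> i \<epsilon> j \<and> apart p n i j"
proof -
  have "p \<in> formulas (insert ISym K) (n + 1)" using formula_p by (rule formulas_mono) blast
  then have "definable (insert ISym K) UNIV (\<lambda>e. holds p (map e [0..<n] @ [e n]))"
    by (intro definable_holds definable_intros) simp
  note bound = collection_tuples[OF this]
  obtain v where mem_v: "\<forall>z. z \<epsilon> v \<longleftrightarrow> inV z i" by (rule smallE[OF small_V[OF I_ord[OF \<open>I i\<close>]]])
  obtain b where b_collects: "\<forall>xs y. length xs = n \<longrightarrow> (\<forall>x \<in> set xs. x \<epsilon> v) \<longrightarrow> holds p (xs @ [y]) \<longrightarrow>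
      (\<exists>y. y \<epsilon> b \<and> holds p (xs @ [y]))"
    using bound[of v] by (elim exE)
  obtain c where b_in_V: "ord c" "\<forall>z. z \<epsilon> b \<longrightarrow> inV z c" using set_in_V by blast
  obtain d where d_above: "ord d" "\<forall>a \<in> set [i, c]. ord a \<longrightarrow> a \<epsilon> d" using ord_above_list by blast
  obtain j where j_above: "I j" "d \<epsilon> j" using I_above[OF d_above(1)] by blast
  then have "i \<epsilon> j" "c \<epsilon> j"
    using d_above(2) b_in_V(1) I_ord \<open>I i\<close> ord_trans[OF I_ord[OF j_above(1)]] by auto
  then have "apart p n i j"
    unfolding apart_def using b_collects mem_v b_in_V(2) inV_mono[OF I_ord[OF j_above(1)]] by metis
  then show ?thesis using j_above(1) \<open>i \<epsilon> j\<close> by blast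
qed

lemma definable_apart:
  assumes "p \<in> formulas L (n + 1)"
  shows "definable L A (\<lambda>e. apart p n (e 0) (e 1))"
  unfolding apart_def using assms by (intro definable_intros definable_holds) simp_all

theorem apart_all:
  assumes formula_p: "p \<in> formulas K (n + 1)" and "I i" "I j" "i \<epsilon> j"
  shows "apart p n i j"
proof -
  obtain k where k_apart: "I k" "i \<epsilon> k" "apart p n i k"
    using apart_some[OF formula_p \<open>I i\<close>] by blast
  have "apart p n i k \<longleftrightarrow> apart p n i j"
    using indiscernible_definable[of "\<lambda>zs. apart p n (zs ! 0) (zs ! 1)" 2 "[i, k]" "[i, j]"]
      definable_apart[OF formula_p] k_apart(1,2) assms(2-4) by (simp add: incr_def)
  then show ?thesis using k_apart(3) by blast
qed

subsection \<open>Diagonal indiscernibility\<close>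

lemma trace_bound:
  assumes formula_p: "p \<in> formulas K (n + 1 + r)" and "I i"
  shows "\<exists>b. ord b \<and> (\<forall>s js. sub s t \<longrightarrow> length js = r \<longrightarrow> incr (i # js) \<longrightarrow> trace p n t i s js \<longrightarrow>
    (\<exists>ks. length ks = r \<and> incr (i # ks) \<and> (\<forall>k \<in> set ks. k \<epsilon> b) \<and> trace p n t i s ks))"
proof -
  let ?S = "\<lambda>s y. ord y \<and> (\<exists>js. length js = r \<and> (incr js \<and> (\<forall>j \<in> set js. i \<epsilon> j) \<and>
    (\<forall>j \<in> set js. j \<epsilon> y) \<and> trace p n t i s js))"
  have "p \<in> formulas (insert ISym K) (n + 1 + r)" using formula_p by (rule formulas_mono) blast
  then have "definable (insert ISym K) UNIV (\<lambda>e. ?S (e 0) (e 1))"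
    unfolding trace_def by (intro definable_intros definable_holds) simp_all
  note bound = collection_partial[OF this]
  obtain u where mem_u: "\<forall>s. s \<epsilon> u \<longleftrightarrow> sub s t" by (rule smallE[OF power])
  obtain w where w_collects: "\<forall>s y. s \<epsilon> u \<longrightarrow> ?S s y \<longrightarrow> (\<exists>y. y \<epsilon> w \<and> ?S s y)"
    using bound[of u] by (elim exE)
  obtain b where b_bound: "ord b" "\<forall>a. a \<epsilon> w \<longrightarrow> ord a \<longrightarrow> a \<epsilon> b" using ord_bound by blast
  have "\<exists>ks. length ks = r \<and> incr (i # ks) \<and> (\<forall>k \<in> set ks. k \<epsilon> b) \<and> trace p n t i s ks"
    if sub_s: "sub s t" and js_trace: "length js = r" "incr (i # js)" "trace p n t i s js" for s js
  proof -
    obtain y where "ord y" "\<forall>j \<in> set js. ord j \<longrightarrow> j \<epsilon> y" using ord_above_list by blast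
    then have "?S s y" using js_trace I_ord unfolding incr_Cons by (auto simp: incr_def)
    then obtain y' ks where "y' \<epsilon> w" "ord y'" "length ks = r" "incr (i # ks)"
      "\<forall>k \<in> set ks. k \<epsilon> y'" "trace p n t i s ks"
      using w_collects mem_u sub_s \<open>I i\<close> unfolding incr_Cons by blast
    then show ?thesis using b_bound ord_trans by blast
  qed
  then show ?thesis using b_bound(1) by blast
qed

lemma agree_some:
  assumes formula_p: "p \<in> formulas K (n + 1 + r)" and "I i"
  shows "\<exists>js ks. length js = r \<and> length ks = r \<and> incr (i # js @ ks) \<and> agree p n i js ks"
proof -
  obtain v where mem_v: "\<forall>z. z \<epsilon> v \<longleftrightarrow> inV z i" by (rule smallE[OF small_V[OF I_ord[OF \<open>I i\<close>]]])
  obtain t where t_codes: "\<forall>xs. length xs = n \<longrightarrow> (\<forall>x \<in> set xs. x \<epsilon> v) \<longrightarrow> (\<exists>c. c \<epsilon> t \<and> coded xs c)"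
    using set_of_codes by blast
  obtain b where ord_b: "ord b" and bound: "\<forall>s js. sub s t \<longrightarrow> length js = r \<longrightarrow> incr (i # js) \<longrightarrow>
      trace p n t i s js \<longrightarrow> (\<exists>ks. length ks = r \<and> incr (i # ks) \<and> (\<forall>k \<in> set ks. k \<epsilon> b) \<and>
      trace p n t i s ks)"
    using trace_bound[OF formula_p \<open>I i\<close>] by blast
  obtain c where c_above: "ord c" "\<forall>a \<in> set [i, b]. ord a \<longrightarrow> a \<epsilon> c" using ord_above_list by blast
  obtain ks where ks_above: "length ks = r" "incr ks" "\<forall>k \<in> set ks. c \<epsilon> k"
    using incr_above[OF c_above(1)] by blast
  have "ord k" if "k \<in> set ks" for k using that ks_above(2) I_ord unfolding incr_def by blast
  then have above: "i \<epsilon> k" "b \<epsilon> k" "ord k" if "k \<in> set ks" for k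
    using that c_above(2) ord_b I_ord[OF \<open>I i\<close>] ks_above(3) ord_trans[of k _ c] by auto
  then have "incr (i # ks)" using ks_above(2) \<open>I i\<close> by (simp add: incr_Cons)
  obtain s where ks_trace: "sub s t" "trace p n t i s ks"
    using trace_exists formula_p ks_above(1) by blast
  then obtain js where js_trace: "length js = r" "incr (i # js)" "\<forall>j \<in> set js. j \<epsilon> b"
    "trace p n t i s js"
    using bound ks_above(1) \<open>incr (i # ks)\<close> by blast
  have "incr (i # js @ ks)"
    using js_trace(2,3) ks_above(2) above ord_trans by (auto simp: incr_Cons incr_append)
  moreover have "agree p n i js ks"
    by (rule agree_if_same_trace[OF _ js_trace(4) ks_trace(2)]) (use t_codes mem_v in simp)
  ultimately show ?thesis using js_trace(1) ks_above(1) by blast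
qed

lemma definable_agree:
  assumes "p \<in> formulas L (n + 1 + r)" "length vs = r" "length ws = r"
  shows "definable L A (\<lambda>e. agree p n (e u) (map e vs) (map e ws))"
  unfolding agree_def using assms by (intro definable_intros definable_holds) simp_all

lemma agree_if_incr:
  assumes formula_p: "p \<in> formulas K (n + 1 + r)"
    and "length js = r" "length ks = r" "incr (i # js @ ks)"
  shows "agree p n i js ks"
proof -
  let ?P = "\<lambda>zs. agree p n (zs ! 0) (take r (drop 1 zs)) (drop (1 + r) zs)"
  have "I i" using assms(4) by (simp add: incr_def)
  then obtain js' ks' where agree: "length js' = r" "length ks' = r" "incr (i # js' @ ks')"
    "agree p n i js' ks'"
    using agree_some[OF formula_p] by blast
  have "definable K {} (\<lambda>e. ?P (map e [0..<1 + r + r]))"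
    using definable_agree[OF formula_p, of "[1..<1 + r]" "[1 + r..<1 + r + r]" "{}" 0]
    by (simp add: take_map drop_map del: upt_Suc)
  then have "?P (i # js' @ ks') \<longleftrightarrow> ?P (i # js @ ks)"
    by (rule indiscernible_definable) (use assms(2-4) agree in simp_all)
  then show ?thesis using assms(2,3) agree by simp
qed

theorem agree_all:
  assumes formula_p: "p \<in> formulas K (n + 1 + r)" and incr_js: "length js = r" "incr (i # js)"
    and incr_ks: "length ks = r" "incr (i # ks)"
  shows "agree p n i js ks"
proof -
  obtain b where b_above: "ord b" "\<forall>a \<in> set (i # js @ ks). ord a \<longrightarrow> a \<epsilon> b"
    using ord_above_list by blast
  obtain ls where ls_above: "length ls = r" "incr ls" "\<forall>l \<in> set ls. b \<epsilon> l"
    using incr_above[OF b_above(1)] by blast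
  have "a \<epsilon> l" if "a \<in> set (i # js @ ks)" "l \<in> set ls" for a l
    using that b_above(2) incr_js(2) incr_ks(2) ls_above(2,3) I_ord ord_trans[of l a b]
    unfolding incr_def by auto
  then have "incr (i # js @ ls)" "incr (i # ks @ ls)"
    using incr_js(2) incr_ks(2) ls_above(2) by (auto simp: incr_Cons incr_append)
  then have "agree p n i js ls" "agree p n i ks ls"
    using agree_if_incr[OF formula_p] incr_js(1) incr_ks(1) ls_above(1) by blast+
  then show ?thesis unfolding agree_def by blast
qed

end

section \<open>Models of the theories\<close>

definition indis_theory :: "sym set \<Rightarrow> fm set" where
  "indis_theory K = ZF K \<union> Coll (insert ISym K) \<union> {Cof} \<union> Indis K"

lemma indis_theory_cases:
  assumes "q \<in> indis_theory K"
  obtains (finite) "q \<in> {Extensionality, Foundation, Pairing, Union, Powerset, Infinity, Cof}"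
  | (separation) n p where "q = separation n p" "p \<in> formulas K (n + 1)"
  | (collection) n p where "q = collection n p" "p \<in> formulas (insert ISym K) (n + 2)"
  | (indiscernibility) n p where "q = indiscernibility n p" "p \<in> formulas K n"
proof -
  have "p \<in> formulas (insert ISym K) k" if "p \<in> formulas K k" for p k
    using that by (rule formulas_mono) blast
  then show thesis
    using assms that unfolding indis_theory_def ZF_def Sep_def Coll_def Indis_def by blast
qed

lemma indis_theory_sentences: "indis_theory K \<subseteq> formulas (insert ISym K) 0"
proof
  fix q assume "q \<in> indis_theory K"
  then show "q \<in> formulas (insert ISym K) 0"
  proof (cases rule: indis_theory_cases)
    case finite
    then show ?thesis
      by (auto simp: Extensionality_def Foundation_def Pairing_def Union_def Powerset_def
        Infinity_def Cof_def)
  next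
    case (separation n p)
    have "p \<in> formulas (insert ISym K) (n + 1)"
      using separation(2) by (rule formulas_mono) blast
    then show ?thesis by (auto simp: separation(1) separation_def intro!: formulas_app)
  next
    case (collection n p)
    then show ?thesis by (auto simp: collection_def intro!: formulas_app)
  next
    case (indiscernibility n p)
    have "p \<in> formulas (insert ISym K) n"
      using indiscernibility(2) by (rule formulas_mono) blast
    then show ?thesis
      by (auto simp: indiscernibility(1) indiscernibility_def Let_def
        intro!: formulas_app formulas_IncrI)
  qed
qed

lemma apartness_sentence:
  assumes "p \<in> formulas L (n + 1)" "ISym \<in> L"
  shows "apartness n p \<in> formulas L 0"
  using assms by (auto simp: apartness_def simp del: upt_Suc intro!: formulas_app)

lemma diagonal_indis_sentence:
  assumes "p \<in> formulas L (n + 1 + r)" "ISym \<in> L" "r \<ge> 1"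
  shows "diagonal_indis n r p \<in> formulas L 0"
  using assms by (auto simp: diagonal_indis_def intro!: formulas_app formulas_IncrI)

context membership_structure
begin

lemma sat_separation:
  assumes "p \<in> formulas L (n + 1)"
  shows "sat e (separation n p) \<longleftrightarrow>
    (\<forall>zs v. length zs = n \<longrightarrow> small (\<lambda>x. x \<epsilon> v \<and> holds p (x # zs)))"
  using assms unfolding separation_def small_def
  by (simp add: sat_app del: upt_Suc)

lemma sat_collection:
  assumes "p \<in> formulas L (n + 2)"
  shows "sat e (collection n p) \<longleftrightarrow> (\<forall>zs v. length zs = n \<longrightarrow>
    (\<forall>x. x \<epsilon> v \<longrightarrow> (\<exists>y. holds p (x # y # zs))) \<longrightarrow>
    (\<exists>w. \<forall>x. x \<epsilon> v \<longrightarrow> (\<exists>y. y \<epsilon> w \<and> holds p (x # y # zs))))"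
  using assms unfolding collection_def
  by (simp add: sat_app del: upt_Suc)

lemma sat_indiscernibility:
  assumes "p \<in> formulas L n"
  shows "sat e (indiscernibility n p) \<longleftrightarrow> (\<forall>xs ys. length xs = n \<longrightarrow> length ys = n \<longrightarrow>
    incr xs \<and> incr ys \<longrightarrow> (holds p xs \<longleftrightarrow> holds p ys))"
  using assms unfolding indiscernibility_def Let_def
  by (simp add: sat_app del: upt_Suc)

lemma small_if_separation_scheme:
  assumes "\<And>n p e. p \<in> formulas L (n + 1) \<Longrightarrow> sat e (separation n p)"
    and "definable L UNIV (\<lambda>e. P (e 0))"
  shows "small (\<lambda>x. x \<epsilon> v \<and> P x)"
proof -
  obtain p zs where p_defines: "p \<in> formulas L (1 + length zs)"
    "\<forall>xs. length xs = 1 \<longrightarrow> (P (xs ! 0) \<longleftrightarrow> holds p (xs @ zs))"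
    using formula_of_definable[of L UNIV "\<lambda>xs. P (xs ! 0)" 1] assms(2) by auto
  then have "small (\<lambda>x. x \<epsilon> v \<and> holds p (x # zs))"
    using assms(1)[of p "length zs"] by (simp add: sat_separation)
  moreover have "P x \<longleftrightarrow> holds p (x # zs)" for x using p_defines(2)[rule_format, of "[x]"] by simp
  ultimately show ?thesis by simp
qed

lemma bound_if_collection_scheme:
  assumes "\<And>n p e. p \<in> formulas L (n + 2) \<Longrightarrow> sat e (collection n p)"
    and "definable L UNIV (\<lambda>e. S (e 0) (e 1))" "\<And>x. x \<epsilon> v \<Longrightarrow> \<exists>y. S x y"
  shows "\<exists>w. \<forall>x. x \<epsilon> v \<longrightarrow> (\<exists>y. y \<epsilon> w \<and> S x y)"
proof -
  obtain p zs where p_defines: "p \<in> formulas L (2 + length zs)"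
    "\<forall>xs. length xs = 2 \<longrightarrow> (S (xs ! 0) (xs ! 1) \<longleftrightarrow> holds p (xs @ zs))"
    using formula_of_definable[of L UNIV "\<lambda>xs. S (xs ! 0) (xs ! 1)" 2] assms(2) by auto
  have "S x y \<longleftrightarrow> holds p (x # y # zs)" for x y using p_defines(2)[rule_format, of "[x, y]"] by simp
  then show ?thesis
    using p_defines(1) assms(1)[of p "length zs"] assms(3) by (simp add: sat_collection)
qed

end

lemma zf_model_of_indis_theory:
  assumes axioms: "\<And>q e. q \<in> indis_theory K \<Longrightarrow> sat_eq (=) E R I e q"
  shows "zf_model E R I K"
proof -
  interpret membership_structure E R I .
  have sat_axiom: "sat e q"
    if "q \<in> {Extensionality, Foundation, Pairing, Union, Powerset, Infinity}" for q e
    using that by (intro axioms) (auto simp: indis_theory_def ZF_def)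
  show ?thesis
  proof
    show "x = y" if "\<And>z. E z x \<longleftrightarrow> E z y" for x y
      using sat_axiom[of Extensionality] that by (auto simp: Extensionality_def)
    show "\<exists>m. E m x \<and> (\<forall>z. E z x \<longrightarrow> \<not> E z m)" if "E y x" for x y
      using sat_axiom[of Foundation] that by (auto simp: Foundation_def Nonempty_def)
    show "small (\<lambda>z. z = a \<or> z = b)" for a b
      using sat_axiom[of Pairing] by (simp add: small_def Pairing_def IsUPair_def)
    show "small (\<lambda>z. \<exists>y. E y x \<and> E z y)" for x
      using sat_axiom[of Union] by (simp add: small_def Union_def)
    show "small (\<lambda>z. sub z x)" for x
      using sat_axiom[of Powerset] by (simp add: small_def Powerset_def)
    show "\<exists>w. (\<exists>z. E z w \<and> (\<forall>u. \<not> E u z)) \<and>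
        (\<forall>x. E x w \<longrightarrow> (\<exists>s. E s w \<and> (\<forall>z. E z s \<longleftrightarrow> E z x \<or> z = x)))"
      using sat_axiom[of Infinity] by (simp add: Infinity_def Nonempty_def IsSucc_def)
    show "small (\<lambda>x. E x v \<and> P x)" if "definable K UNIV (\<lambda>e. P (e 0))" for P v
      by (rule small_if_separation_scheme[OF axioms that])
        (auto simp: indis_theory_def ZF_def Sep_def)
    show "\<exists>w. \<forall>x. E x v \<longrightarrow> (\<exists>y. E y w \<and> S x y)"
      if "definable (insert ISym K) UNIV (\<lambda>e. S (e 0) (e 1))" "\<And>x. E x v \<Longrightarrow> \<exists>y. S x y" for S v
      by (rule bound_if_collection_scheme[OF axioms that]) (auto simp: indis_theory_def Coll_def)
  qed
qed

lemma indiscernible_model_of_indis_theory: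
  assumes axioms: "\<And>q e. q \<in> indis_theory K \<Longrightarrow> sat_eq (=) E R I e q"
  shows "indiscernible_model E R I K"
proof -
  interpret zf_model E R I K using axioms by (rule zf_model_of_indis_theory)
  have sat_Cof: "sat e Cof" for e by (rule axioms) (simp add: indis_theory_def)
  show ?thesis
  proof
    show "ord i" if "I i" for i using sat_Cof that by (simp add: Cof_def)
    show "\<exists>i. I i \<and> (E a i \<or> a = i)" if "ord a" for a using sat_Cof that by (simp add: Cof_def)
    show "holds p xs \<longleftrightarrow> holds p ys"
      if "p \<in> formulas K (length xs)" "length ys = length xs" "incr xs" "incr ys" for p xs ys
    proof -
      have "indiscernibility (length xs) p \<in> indis_theory K"
        using that(1) unfolding indis_theory_def Indis_def by blast
      then have "sat undefined (indiscernibility (length xs) p)" by (rule axioms)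
      then show ?thesis using sat_indiscernibility[OF that(1)] that(2-4) by blast
    qed
  qed
qed

lemma indis_theory_derives:
  assumes "p \<in> formulas (insert ISym K) 0"
    and "\<And>(E :: nat \<Rightarrow> nat \<Rightarrow> bool) R I e. indiscernible_model E R I K \<Longrightarrow> sat_eq (=) E R I e p"
  shows "derives (insert ISym K) (indis_theory K) p"
proof (rule completeness[OF indis_theory_sentences])
  show "syms p \<subseteq> insert ISym K" using assms(1) by (simp add: formulas_def)
  show "Pairing \<in> indis_theory K" "Infinity \<in> indis_theory K"
    by (simp_all add: indis_theory_def ZF_def)
  show "sat_eq (=) E R I e p" if "\<And>q e. q \<in> indis_theory K \<Longrightarrow> sat_eq (=) E R I e q"
    for E :: "nat \<Rightarrow> nat \<Rightarrow> bool" and R I e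
    using that by (intro assms(2) indiscernible_model_of_indis_theory)
qed

lemma derives_apartness:
  assumes "p \<in> formulas K (n + 1)"
  shows "derives (insert ISym K) (indis_theory K) (apartness n p)"
proof (rule indis_theory_derives)
  show "apartness n p \<in> formulas (insert ISym K) 0"
    using formulas_mono[OF assms subset_insertI] by (rule apartness_sentence) simp
next
  fix E R :: "nat \<Rightarrow> nat \<Rightarrow> bool" and I e assume "indiscernible_model E R I K"
  then interpret indiscernible_model E R I K .
  show "sat e (apartness n p)" using apart_all[OF assms] by (simp add: sat_apartness[OF assms])
qed

lemma derives_diagonal_indis:
  assumes "p \<in> formulas K (n + 1 + r)" "r \<ge> 1"
  shows "derives (insert ISym K) (indis_theory K) (diagonal_indis n r p)"
proof (rule indis_theory_derives)
  show "diagonal_indis n r p \<in> formulas (insert ISym K) 0"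
    using formulas_mono[OF assms(1) subset_insertI]
    by (rule diagonal_indis_sentence) (use assms in simp_all)
next
  fix E R :: "nat \<Rightarrow> nat \<Rightarrow> bool" and I e assume "indiscernible_model E R I K"
  then interpret indiscernible_model E R I K .
  show "sat e (diagonal_indis n r p)"
    using agree_all[OF assms(1)] incr_ConsI by (simp add: sat_diagonal_indis[OF assms])
qed

theorem theorem3p2:
  "(\<forall>n p. p \<in> formulas {} (n + 1) \<longrightarrow> derives {ISym} ZFI (apartness n p))
    \<and> (\<forall>n r p. r \<ge> 1 \<longrightarrow> p \<in> formulas {} (n + 1 + r) \<longrightarrow> derives {ISym} ZFI (diagonal_indis n r p))
    \<and> (\<forall>n p. p \<in> formulas {LessSym} (n + 1) \<longrightarrow>
          derives {LessSym, ISym} ZFI_less (apartness n p))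
    \<and> (\<forall>n r p. r \<ge> 1 \<longrightarrow> p \<in> formulas {LessSym} (n + 1 + r) \<longrightarrow>
          derives {LessSym, ISym} ZFI_less (diagonal_indis n r p))"
proof -
  have ZFI: "ZFI = indis_theory {}" by (simp add: ZFI_def indis_theory_def)
  have language: "{LessSym, ISym} = insert ISym {LessSym}" by blast
  have ZFI_less: "indis_theory {LessSym} \<subseteq> ZFI_less"
    by (auto simp: ZFI_less_def indis_theory_def language)
  show ?thesis
    unfolding ZFI language
    using derives_apartness derives_diagonal_indis derives_weaken[OF _ ZFI_less] by blast
qed

end
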